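(* Let $D\ge2$ be an integer, $E_0,\ldots,E_D\in\mathbb{R}$ and $\beta\in\mathbb{R}$. Let $Y_n$ be the number of vertices of height $n$ in the random tree with distribution $P_\infty$. The process $(Y_n)_{n=0}^\infty$ is Markov with transition probability $$\mathsf{P}\{Y_{n+1}=k'\mid Y_n=k\}=\frac{k'}{k}\,\rho^{k'-k}\sigma^{k}\sum_{\substack{0\le i_1,\ldots,i_k\le D\\ i_1+\cdots+i_k=k'}}e^{-\beta(E_{i_1}+\cdots+E_{i_k})}.$$
   Context: Trees. $\mathbb{N}=\{1,2,\ldots\}$. A plane tree is a rooted tree in which the child subtrees of every vertex are linearly ordered (up to isomorphism preserving the root and these orders). The branching number $\deg(v)$ is the number of children of $v$; the height of $v$ is its distance to the root; the height of a finite tree is the maximal height of its vertices. $\mathbb{T}_N$ is the set of plane trees on $N$ vertices with all branching numbers at most $D$; $\mu_N\{T\}=e^{-\beta E(T)}/Z_N$ for $T\in\mathbb{T}_N$, with $E(T)=\sum_{v\in V(T)}E_{\deg(v)}$ ($V(T)$ being the vertex set) and $Z_N=\sum_{T\in\mathbb{T}_N}e^{-\beta E(T)}$. $\pi_n T$ is the subtree of $T$ spanned by all vertices of height at most $n$. $S_n$ is the set of plane trees of height exactly $n$ with all branching numbers at most $D$. $P_n$ is the probability measure on $S_n$ that is the limit in total variation, as $N\to\infty$, of the push-forwards of $\mu_N$ under $\pi_n$ (this limit exists). $P_\infty$ is the unique probability measure on the space of all (finite or infinite) plane trees with branching numbers at most $D$ whose push-forward under $\pi_n$ is $P_n$ for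 every $n\in\mathbb{N}$; it is concentrated on infinite trees (so $Y_0=1$ and $Y_n\ge1$ for all $n$). Parameters. Let $\Delta=\{p\in[0,1]^{D+1}:\ \sum_{i=0}^D p_i=1,\ \sum_{i=0}^D i p_i=1\}$ and $J(p)=\sum_{i=0}^D p_i\ln p_i+\beta\sum_{i=0}^D p_iE_i$ (with $0\ln0=0$). $J$ has a unique minimizer $p^*$ on $\Delta$, of the form $p_i^*=Ce^{-\beta E_i}\rho^i$, where $\rho>0$ is the unique positive solution of $\sum_{i=0}^D e^{-\beta E_i}\rho^i=\sum_{i=0}^D i e^{-\beta E_i}\rho^i$ and $1/C=\sum_{i=0}^De^{-\beta E_i}\rho^i$. $\sigma=e^{J(p^* )}$. The formula for the conditional probability is for $k,k'\in\mathbb{N}$ with $\mathsf{P}\{Y_n=k\}>0$. *)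

theory Defs
  imports "HOL-Probability.Probability"
begin

text \<open>Locally finite plane trees, of finite or infinite height. Since the children of a vertex form
  a list, equality in this type is isomorphism of plane trees.\<close>

codatatype plane_tree = Node (children: "plane_tree list")

text \<open>A vertex is addressed by the path from the root (Ulam--Harris labelling), so that its height
  is the length of its address.\<close>

primrec is_vertex :: "nat list \<Rightarrow> plane_tree \<Rightarrow> bool" where
  "is_vertex [] t \<longleftrightarrow> True"
| "is_vertex (i # v) t \<longleftrightarrow> i < length (children t) \<and> is_vertex v (children t ! i)"

definition vertices :: "plane_tree \<Rightarrow> nat list set" where
  "vertices t = {v. is_vertex v t}"

primrec subtree_at :: "nat list \<Rightarrow> plane_tree \<Rightarrow> plane_tree" where
  "subtree_at [] t = t"
| "subtree_at (i # v) t = subtree_at v (children t ! i)"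

definition branching :: "plane_tree \<Rightarrow> nat list \<Rightarrow> nat" where
  "branching t v = length (children (subtree_at v t))"

definition tree_height :: "plane_tree \<Rightarrow> nat" where
  "tree_height t = Max (length ` vertices t)"

definition level_size :: "nat \<Rightarrow> plane_tree \<Rightarrow> nat" where
  "level_size n t = card {v \<in> vertices t. length v = n}"

definition bounded_trees :: "nat \<Rightarrow> plane_tree set" where
  "bounded_trees D = {t. \<forall>v \<in> vertices t. branching t v \<le> D}"

definition trees_of_size :: "nat \<Rightarrow> nat \<Rightarrow> plane_tree set" where
  "trees_of_size D N = {t \<in> bounded_trees D. finite (vertices t) \<and> card (vertices t) = N}"

definition trees_of_height :: "nat \<Rightarrow> nat \<Rightarrow> plane_tree set" where
  "trees_of_height D n = {t \<in> bounded_trees D. finite (vertices t) \<and> tree_height t = n}"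

text \<open>The truncation \<open>\<pi>\<^sub>n\<close>; by \<open>vertices_trunc\<close> below, it is the subtree spanned by the vertices
  of height at most \<open>n\<close>.\<close>

primrec trunc :: "nat \<Rightarrow> plane_tree \<Rightarrow> plane_tree" where
  "trunc 0 t = Node []"
| "trunc (Suc n) t = Node (map (trunc n) (children t))"

lemma is_vertex_trunc: "is_vertex v (trunc n t) \<longleftrightarrow> is_vertex v t \<and> length v \<le> n"
proof (induction n arbitrary: v t)
  case 0
  then show ?case by (cases v) auto
next
  case (Suc n)
  then show ?case by (cases v) auto
qed

lemma vertices_trunc: "vertices (trunc n t) = {v \<in> vertices t. length v \<le> n}"
  by (auto simp: vertices_def is_vertex_trunc)

definition tree_energy :: "(nat \<Rightarrow> real) \<Rightarrow> plane_tree \<Rightarrow> real" where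
  "tree_energy E t = (\<Sum>v \<in> vertices t. E (branching t v))"

definition partition_function :: "nat \<Rightarrow> (nat \<Rightarrow> real) \<Rightarrow> real \<Rightarrow> nat \<Rightarrow> real" where
  "partition_function D E \<beta> N = (\<Sum>t \<in> trees_of_size D N. exp (- \<beta> * tree_energy E t))"

text \<open>The Gibbs measure \<open>\<mu>\<^sub>N\<close>. It is only meaningful for \<open>N \<ge> 1\<close>, where the set of trees is
  finite and (for \<open>D \<ge> 1\<close>) nonempty, so that the weights sum to 1.\<close>

definition gibbs_pmf :: "nat \<Rightarrow> (nat \<Rightarrow> real) \<Rightarrow> real \<Rightarrow> nat \<Rightarrow> plane_tree pmf" where
  "gibbs_pmf D E \<beta> N = embed_pmf (\<lambda>t. if t \<in> trees_of_size D N
     then exp (- \<beta> * tree_energy E t) / partition_function D E \<beta> N else 0)"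

definition tv_dist :: "'a pmf \<Rightarrow> 'a pmf \<Rightarrow> real" where
  "tv_dist p q = (SUP A. \<bar>measure_pmf.prob p A - measure_pmf.prob q A\<bar>)"

definition is_truncated_limit_law ::
    "nat \<Rightarrow> (nat \<Rightarrow> real) \<Rightarrow> real \<Rightarrow> nat \<Rightarrow> plane_tree pmf \<Rightarrow> bool" where
  "is_truncated_limit_law D E \<beta> n p \<longleftrightarrow>
     set_pmf p \<subseteq> trees_of_height D n \<and>
     (\<lambda>N. tv_dist (map_pmf (trunc n) (gibbs_pmf D E \<beta> N)) p) \<longlonglongrightarrow> 0"

text \<open>The \<open>\<sigma>\<close>-algebra on the space of all trees with branching numbers at most \<open>D\<close> is the one
  generated by the truncations, i.e. the Borel \<open>\<sigma>\<close>-algebra of local convergence.\<close>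

definition tree_space :: "nat \<Rightarrow> plane_tree measure" where
  "tree_space D = sigma (bounded_trees D) {{t \<in> bounded_trees D. trunc n t = s} |n s. True}"

definition is_limit_tree_law ::
    "nat \<Rightarrow> (nat \<Rightarrow> real) \<Rightarrow> real \<Rightarrow> plane_tree measure \<Rightarrow> bool" where
  "is_limit_tree_law D E \<beta> P \<longleftrightarrow>
     prob_space P \<and> sets P = sets (tree_space D) \<and>
     (\<forall>n\<ge>1. \<exists>p. is_truncated_limit_law D E \<beta> n p \<and>
        distr P (count_space UNIV) (trunc n) = measure_pmf p)"

text \<open>Vectors indexed by \<open>0, \<dots>, D\<close> are extensional functions on \<open>{..D}\<close>.\<close>

definition branching_simplex :: "nat \<Rightarrow> (nat \<Rightarrow> real) set" where
  "branching_simplex D =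
     {p \<in> {..D} \<rightarrow>\<^sub>E {0..1}. (\<Sum>i\<le>D. p i) = 1 \<and> (\<Sum>i\<le>D. real i * p i) = 1}"

text \<open>The convention \<open>0 ln 0 = 0\<close> holds automatically.\<close>

definition free_energy :: "nat \<Rightarrow> (nat \<Rightarrow> real) \<Rightarrow> real \<Rightarrow> (nat \<Rightarrow> real) \<Rightarrow> real" where
  "free_energy D E \<beta> p = (\<Sum>i\<le>D. p i * ln (p i)) + \<beta> * (\<Sum>i\<le>D. p i * E i)"

definition optimal_branching :: "nat \<Rightarrow> (nat \<Rightarrow> real) \<Rightarrow> real \<Rightarrow> nat \<Rightarrow> real" where
  "optimal_branching D E \<beta> = arg_min (free_energy D E \<beta>) (\<lambda>p. p \<in> branching_simplex D)"

definition rho :: "nat \<Rightarrow> (nat \<Rightarrow> real) \<Rightarrow> real \<Rightarrow> real" where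
  "rho D E \<beta> = (THE r. r > 0 \<and>
     (\<Sum>i\<le>D. exp (- \<beta> * E i) * r ^ i) = (\<Sum>i\<le>D. real i * exp (- \<beta> * E i) * r ^ i))"

definition sigma_const :: "nat \<Rightarrow> (nat \<Rightarrow> real) \<Rightarrow> real \<Rightarrow> real" where
  "sigma_const D E \<beta> = exp (free_energy D E \<beta> (optimal_branching D E \<beta>))"

definition is_markov :: "'a measure \<Rightarrow> (nat \<Rightarrow> 'a \<Rightarrow> nat) \<Rightarrow> bool" where
  "is_markov M X \<longleftrightarrow>
     (\<forall>n. X n \<in> M \<rightarrow>\<^sub>M count_space UNIV) \<and>
     (\<forall>n y (x :: nat \<Rightarrow> nat). \<P>(\<omega> in M. \<forall>i\<le>n. X i \<omega> = x i) > 0 \<longrightarrow>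
        \<P>(\<omega> in M. X (Suc n) \<omega> = y \<bar> \<forall>i\<le>n. X i \<omega> = x i) =
        \<P>(\<omega> in M. X (Suc n) \<omega> = y \<bar> X n \<omega> = x n))"

end

theory Submission imports Defs begin

text \<open>Removing the \<open>k\<close> roots of a forest leaves a word of \<open>k\<close> branching numbers and the forest of
  their children. Hence, with \<open>w\<^sub>i = e\<^bsup>-\<beta>E\<^sub>i\<^esup>\<close> and \<open>W x = \<Sum>w\<^sub>i x\<^sup>i\<close>, the Gibbs probability that the
  levels \<open>0, \<dots>, n\<close> have prescribed sizes is a product of coefficients of powers of \<open>W\<close>, one for each
  pair of consecutive levels, times \<open>Z k (N - M) / Z 1 N\<close>. Here \<open>k\<close> is the size of level \<open>n\<close>, \<open>M\<close> is the
  number of vertices of smaller height, and \<open>Z k N\<close> is the total weight of the forests of \<open>k\<close> trees with \<open>N\<close>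
  vertices. The theorem amounts to the limit \<open>k \<rho>\<^bsup>k-1\<^esup> \<sigma>\<^sup>M\<close> of this quotient.

  By the Otter--Dwass formula, \<open>N * Z k N\<close> is \<open>k\<close> times the coefficient of \<open>x\<^bsup>N-k\<^esup>\<close> in \<open>W\<^sup>N\<close>. Since
  the limit laws are assumed to exist, \<open>Z 1 N / Z 1 (N + 1)\<close> converges, necessarily to the radius of
  convergence of the generating function \<open>S\<close> of trees, which the equation \<open>S = x W(S)\<close> identifies as
  \<open>\<sigma> = \<rho> / W(\<rho>)\<close>. The remaining ratios follow by Neveu's argument for strong ratio limit theorems:
  the normalized coefficients near the diagonal do not decay exponentially, so that tilting the weight
  of one branching number and Jensen's inequality pin down its frequency.\<close>

section \<open>Coefficients of powers\<close>

text \<open>For fixed \<open>t\<close>, division by \<open>t\<close> bounds \<open>q n\<close>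
  asymptotically by \<open>h t / t\<close>, from above if \<open>t > 0\<close> and from below if
  \<open>t < 0\<close>; both bounds tend to \<open>p\<close> as \<open>t\<close> tends to 0.\<close>

lemma tendsto_of_linear_bounds:
  fixes h :: "real \<Rightarrow> real" and q e :: "nat \<Rightarrow> real"
  assumes bound: "\<And>t. \<forall>\<^sub>F n in sequentially. t * q n \<le> h t + e n"
    and e: "e \<longlonglongrightarrow> 0" and h0: "h 0 = 0" and h: "(h has_real_derivative p) (at 0)"
  shows "q \<longlonglongrightarrow> p"
proof (rule order_tendstoI)
  have lim: "((\<lambda>t. h t / t) \<longlongrightarrow> p) (at 0)"
    using h h0 by (simp add: has_field_derivative_iff)
  fix a :: real
  {
    assume "a < p"
    then have "\<forall>\<^sub>F t in at 0. a < h t / t"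
      using lim by (rule order_tendstoD(1)[rotated])
    then have "\<forall>\<^sub>F t in at_left 0. a < h t / t"
      by (simp add: eventually_at_split)
    moreover have "\<forall>\<^sub>F t in at_left (0::real). t < 0"
      by (simp add: eventually_at_filter)
    ultimately obtain t where t: "t < 0" "a < h t / t"
      using eventually_happens'[OF trivial_limit_at_left_real[of 0] eventually_conj] by blast
    have "(\<lambda>n. h t / t + e n / t) \<longlonglongrightarrow> h t / t + 0 / t"
      by (intro tendsto_intros e) (use t in auto)
    then have "\<forall>\<^sub>F n in sequentially. a < h t / t + e n / t"
      using t by (intro order_tendstoD(1)) auto
    with bound[of t] show "\<forall>\<^sub>F n in sequentially. a < q n"
    proof eventually_elim
      case (elim n)
      have "h t / t + e n / t \<le> q n"
        using elim(1) t by (simp add: field_simps)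
      with elim show ?case by simp
    qed
  }
  {
    assume "p < a"
    then have "\<forall>\<^sub>F t in at 0. h t / t < a"
      using lim by (rule order_tendstoD(2)[rotated])
    then have "\<forall>\<^sub>F t in at_right 0. h t / t < a"
      by (simp add: eventually_at_split)
    moreover have "\<forall>\<^sub>F t in at_right (0::real). 0 < t"
      by (simp add: eventually_at_right_less)
    ultimately obtain t where t: "0 < t" "h t / t < a"
      using eventually_happens'[OF trivial_limit_at_right_real[of 0] eventually_conj] by blast
    have "(\<lambda>n. h t / t + e n / t) \<longlonglongrightarrow> h t / t + 0 / t"
      by (intro tendsto_intros e) (use t in auto)
    then have "\<forall>\<^sub>F n in sequentially. h t / t + e n / t < a"
      using t by (intro order_tendstoD(2)) auto
    with bound[of t] show "\<forall>\<^sub>F n in sequentially. q n < a"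
    proof eventually_elim
      case (elim n)
      have "q n \<le> h t / t + e n / t"
        using elim(1) t by (simp add: field_simps)
      with elim show ?case by simp
    qed
  }
qed

text \<open>Beyond some \<open>M\<close> the increments are below \<open>r / 2\<close>, which makes
  the growth sublinear. Applied to logarithms, this turns ratios tending to 1 into the absence of
  exponential decay.\<close>

lemma LIMSEQ_div_of_differences:
  fixes x :: "nat \<Rightarrow> real"
  assumes "(\<lambda>n. x (Suc n) - x n) \<longlonglongrightarrow> 0"
  shows "(\<lambda>n. x n / real n) \<longlonglongrightarrow> 0"
proof (rule LIMSEQ_I)
  fix r :: real assume r: "r > 0"
  obtain M where M: "\<And>n. n \<ge> M \<Longrightarrow> \<bar>x (Suc n) - x n\<bar> < r / 2"
    using LIMSEQ_D[OF assms, of "r/2"] r by auto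
  have *: "\<bar>x (M + j) - x M\<bar> \<le> real j * (r / 2)" for j
  proof (induction j)
    case (Suc j)
    have "\<bar>x (M + Suc j) - x M\<bar> \<le> \<bar>x (Suc (M + j)) - x (M + j)\<bar> + \<bar>x (M + j) - x M\<bar>"
      by simp
    with Suc M[of "M + j"] show ?case by (simp add: algebra_simps)
  qed simp
  have "(\<lambda>n. \<bar>x M\<bar> / real n) \<longlonglongrightarrow> 0"
    by (rule real_tendsto_divide_at_top[OF tendsto_const filterlim_real_sequentially])
  then obtain K where K: "\<And>n. n \<ge> K \<Longrightarrow> \<bar>x M\<bar> / real n < r / 2"
    using LIMSEQ_D[of _ 0 "r/2"] r by fastforce
  show "\<exists>no. \<forall>n\<ge>no. norm (x n / real n - 0) < r"
  proof (intro exI allI impI)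
    fix n assume n: "n \<ge> Suc (M + K)"
    have "\<bar>x n\<bar> \<le> \<bar>x M\<bar> + \<bar>x n - x M\<bar>"
      by simp
    also have "\<dots> \<le> \<bar>x M\<bar> + real (n - M) * (r / 2)"
      using *[of "n - M"] n by simp
    also have "\<dots> \<le> \<bar>x M\<bar> + real n * (r / 2)"
      using r by (intro add_left_mono mult_right_mono) auto
    also have "\<dots> < real n * r"
      using K[of n] n r by (simp add: field_simps)
    finally show "norm (x n / real n - 0) < r"
      using n by (simp add: field_simps)
  qed
qed

section \<open>Power series with nonnegative coefficients\<close>

unbundle no vec_syntax
unbundle fps_syntax

lemma fps_mult_mono_nth:
  fixes f g h :: "real fps"
  assumes "\<And>n. h $ n \<ge> 0" "\<And>n. f $ n \<le> g $ n"
  shows "(h * f) $ n \<le> (h * g) $ n"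
  unfolding fps_mult_nth by (intro sum_mono mult_left_mono assms)

lemma fps_power_nonneg:
  fixes f :: "real fps"
  assumes "\<And>n. f $ n \<ge> 0"
  shows "(f ^ N) $ n \<ge> 0"
proof (induction N arbitrary: n)
  case (Suc N)
  then show ?case by (simp add: fps_mult_nth assms sum_nonneg)
qed (simp add: fps_one_nth)

text \<open>Chernoff's bound: one term of the power, evaluated at \<open>r\<close>, is at most the
  whole value. Induction on \<open>N\<close> replaces the evaluation of formal series.\<close>

lemma fps_power_nth_bound:
  fixes f :: "real fps"
  assumes nn: "\<And>n. f $ n \<ge> 0" and deg: "\<And>n. n > D \<Longrightarrow> f $ n = 0" and r: "r \<ge> 0"
  shows "(f ^ N) $ m * r ^ m \<le> (\<Sum>i\<le>D. f $ i * r ^ i) ^ N"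
proof (induction N arbitrary: m)
  case 0
  then show ?case by (simp add: fps_one_nth)
next
  case (Suc N)
  let ?S = "\<Sum>i\<le>D. f $ i * r ^ i"
  have S: "?S \<ge> 0" by (intro sum_nonneg) (use nn r in auto)
  have "(f ^ Suc N) $ m * r ^ m = (\<Sum>i\<le>m. (f $ i * r ^ i) * ((f ^ N) $ (m - i) * r ^ (m - i)))"
    by (simp add: fps_mult_nth sum_distrib_right atLeast0AtMost flip: power_add)
      (intro sum.cong, auto simp: algebra_simps simp flip: power_add)
  also have "\<dots> \<le> (\<Sum>i\<le>m. (f $ i * r ^ i) * ?S ^ N)"
    by (intro sum_mono mult_left_mono Suc) (use nn r in auto)
  also have "\<dots> = (\<Sum>i\<le>m. f $ i * r ^ i) * ?S ^ N"
    by (simp add: sum_distrib_right)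
  also have "(\<Sum>i\<le>m. f $ i * r ^ i) = (\<Sum>i\<in>{..m} \<inter> {..D}. f $ i * r ^ i)"
    by (intro sum.mono_neutral_right) (auto simp: deg)
  also have "\<dots> \<le> ?S"
    by (intro sum_mono2) (use nn r in auto)
  finally show ?case using S by (simp add: mult_right_mono)
qed

text \<open>Jensen's inequality for the number of marks: when the factors \<open>u\<close> in the expansion of
  \<open>((f - u) + u) ^ N\<close> are marked, \<open>((f - u) + e\<^sup>t u) ^ N\<close> is the exponential moment of the number of
  marks and \<open>N u f ^ (N - 1)\<close> its first moment; exp is bounded below by its tangent at \<open>t * a\<close>.\<close>

lemma fps_power_exp_moment:
  fixes f u :: "real fps"
  assumes u: "\<And>n. u $ n \<ge> 0" and fu: "\<And>n. (f - u) $ n \<ge> 0"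
  shows "exp (t * a) * ((1 - t * a) * (f ^ N) $ m + t * real N * (u * f ^ (N - 1)) $ m)
    \<le> ((f + fps_const (exp t - 1) * u) ^ N) $ m"
proof (induction N arbitrary: a m)
  case 0
  have "exp (t * a) * (1 - t * a) \<le> exp (t * a) * exp (- (t * a))"
    using exp_ge_add_one_self[of "- (t * a)"] by (intro mult_left_mono) auto
  then show ?case by (simp add: exp_minus fps_one_nth)
next
  case (Suc N)
  define v where "v = f + fps_const (exp t - 1) * u"
  \<comment> \<open>\<open>l a\<close> is the tangent bound for \<open>N\<close> factors. An
    unmarked extra factor leaves the centre \<open>a\<close> as it is; a marked one has weight
    \<open>exp t\<close> and shifts the centre to \<open>a - 1\<close>.\<close>
  define l where "l a = fps_const (exp (t * a) * (1 - t * a)) * f ^ N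
    + fps_const (exp (t * a) * t * real N) * (u * f ^ (N - 1))" for a
  have l: "l a $ m \<le> (v ^ N) $ m" for a m
    using Suc[of a m] by (simp add: l_def v_def) (simp add: algebra_simps)
  have "(f - u) * l a + fps_const (exp t) * u * l (a - 1) =
    fps_const (exp (t * a) * (1 - t * a)) * f ^ Suc N
    + fps_const (exp (t * a) * t * real (Suc N)) * (u * f ^ N)"
  proof -
    have e: "exp (t * (a - 1)) = exp (t * a) / exp t" by (simp add: algebra_simps exp_diff)
    have "fps_const (exp t) * l (a - 1) = l a + fps_const (exp (t * a) * t) * f ^ N"
      unfolding fps_eq_iff l_def fps_mult_left_const_nth fps_add_nth e
      by (simp add: field_simps)
    then have "(f - u) * l a + fps_const (exp t) * u * l (a - 1) =
       f * l a + fps_const (exp (t * a) * t) * u * f ^ N"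
      by (simp add: algebra_simps)
    \<comment> \<open>\<open>f * f ^ (N - 1)\<close> is \<open>f ^ N\<close> only for
      \<open>N > 0\<close>; at \<open>N = 0\<close> the factor \<open>real N\<close> removes the
      term.\<close>
    moreover have "f * l a = fps_const (exp (t * a) * (1 - t * a)) * f ^ Suc N
        + fps_const (exp (t * a) * t * real N) * (u * f ^ N)"
      by (cases N) (simp_all add: l_def algebra_simps)
    moreover have "fps_const (exp (t * a) * t * real (Suc N)) =
        fps_const (exp (t * a) * t * real N) + fps_const (exp (t * a) * t)"
      by (simp add: algebra_simps)
    ultimately show ?thesis
      by (simp only: distrib_right mult.assoc add_ac)
  qed
  note step = this
  have "exp (t * a) * ((1 - t * a) * (f ^ Suc N) $ m + t * real (Suc N) * (u * f ^ (Suc N - 1)) $ m)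
     = ((f - u) * l a + fps_const (exp t) * u * l (a - 1)) $ m"
    unfolding step fps_add_nth fps_mult_left_const_nth diff_Suc_1 by (simp add: algebra_simps)
  also have "\<dots> \<le> ((f - u) * v ^ N + fps_const (exp t) * u * v ^ N) $ m"
    unfolding fps_add_nth
    by (intro add_mono fps_mult_mono_nth fu l) (simp add: u)
  also have "(f - u) * v ^ N + fps_const (exp t) * u * v ^ N = v ^ Suc N"
    by (simp add: v_def algebra_simps flip: fps_const_sub)
  finally show ?case by (simp add: v_def)
qed

text \<open>Comparison of coefficients in \<open>(N + k) X (f^k)' f^N = k X (f^(N+k))'\<close>. The
  sum is the one that arises in the induction for the Otter-Dwass formula.\<close>

lemma fps_power_times_deriv_nth:
  fixes f :: "real fps"
  shows "real (N + k) * (\<Sum>j\<le>m. real j * (f ^ k) $ j * (f ^ N) $ (m - j)) = real k * real m * (f ^ (N + k)) $ m"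
proof (cases k)
  case (Suc l)
  have "(\<Sum>j\<le>m. real j * (f ^ k) $ j * (f ^ N) $ (m - j)) = (fps_X * fps_deriv (f ^ k) * f ^ N) $ m"
    unfolding fps_mult_nth[of "fps_X * fps_deriv (f ^ k)"] atLeast0AtMost
    by (intro sum.cong refl) (auto simp: fps_X_mult_nth)
  moreover have "fps_const (real (N + k)) * (fps_X * fps_deriv (f ^ k) * f ^ N) =
      fps_const (real k) * (fps_X * fps_deriv (f ^ (N + k)))"
  proof -
    have "f ^ (N + l) = f ^ l * f ^ N" by (simp add: power_add)
    then show ?thesis
      unfolding fps_deriv_power by (simp add: Suc mult_ac)
  qed
  ultimately have "real (N + k) * (\<Sum>j\<le>m. real j * (f ^ k) $ j * (f ^ N) $ (m - j)) =
      (fps_const (real k) * (fps_X * fps_deriv (f ^ (N + k)))) $ m"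
    by (metis fps_mult_left_const_nth)
  also have "\<dots> = real k * real m * (f ^ (N + k)) $ m"
    by (cases m) (auto simp: fps_X_mult_nth)
  finally show ?thesis .
qed (auto intro!: sum.neutral)

section \<open>The weights and the critical point\<close>

locale branching_weights =
  fixes D :: nat and w :: "nat \<Rightarrow> real"
  assumes D: "D \<ge> 2" and w: "\<And>i. w i > 0"
begin

definition W :: "real fps" where
  "W = Abs_fps (\<lambda>i. if i \<le> D then w i else 0)"

definition phi :: "real \<Rightarrow> real" where
  "phi x = (\<Sum>i\<le>D. w i * x ^ i)"

definition r :: real where
  "r = (THE r. r > 0 \<and> (\<Sum>i\<le>D. w i * r ^ i) = (\<Sum>i\<le>D. real i * w i * r ^ i))"

text \<open>The maximum of \<open>x / phi x\<close> over \<open>x \<ge> 0\<close>, by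
  \<open>phi_tangent\<close>; it turns out to be both the radius of convergence of the generating
  function of trees and \<open>sigma_const\<close>.\<close>

definition s :: real where
  "s = r / phi r"

text \<open>The right side minus the left side is \<open>h\<close>, with constant term
  \<open>- w 0\<close>, no linear term, and positive coefficients from degree 2 to \<open>D\<close>.
  So \<open>h\<close> is strictly increasing on the nonnegative reals and changes sign.\<close>

lemma r_unique: "\<exists>!r. r > 0 \<and> (\<Sum>i\<le>D. w i * r ^ i) = (\<Sum>i\<le>D. real i * w i * r ^ i)"
proof -
  define h where "h x = (\<Sum>i\<le>D. (real i - 1) * w i * x ^ i)" for x
  have split: "h x = - w 0 + (\<Sum>i=2..D. (real i - 1) * w i * x ^ i)" for x
  proof -
    have "{..D} = {0, 1} \<union> {2..D}" using D by auto
    then show ?thesis by (simp add: h_def)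
  qed
  have mono: "h x < h y" if "0 \<le> x" "x < y" for x y
    unfolding split using that D w
    by (intro add_strict_left_mono sum_strict_mono) (auto intro!: power_strict_mono)
  \<comment> \<open>Chosen so that \<open>w 2 * y = w 2 + w 0\<close>, whence the quadratic term
    alone outweighs \<open>w 0\<close>.\<close>
  define y where "y = 1 + w 0 / w 2"
  have y: "y \<ge> 1" using w[of 0] w[of 2] by (simp add: y_def)
  have "w 0 \<le> w 2 * y"
    using w[of 2] by (simp add: y_def distrib_left)
  also have "\<dots> \<le> w 2 * y ^ 2"
    using w[of 2] y by (intro mult_left_mono) (auto simp: power2_eq_square)
  also have "\<dots> = (\<Sum>i\<in>{2}. (real i - 1) * w i * y ^ i)"
    by simp
  also have "\<dots> \<le> (\<Sum>i=2..D. (real i - 1) * w i * y ^ i)"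
    using D y w by (intro sum_mono2) (auto intro!: mult_nonneg_nonneg simp: less_imp_le)
  finally have "h y \<ge> 0" by (simp add: split)
  moreover have h0: "h 0 < 0"
    using w[of 0] by (simp add: split)
  moreover have "continuous_on {0..y} h"
    unfolding h_def by (intro continuous_intros)
  ultimately obtain x where x: "0 \<le> x" "h x = 0"
    using IVT'[of h 0 0 y] y by auto
  have "x \<noteq> 0" using x h0 by auto
  have iff: "(\<Sum>i\<le>D. w i * z ^ i) = (\<Sum>i\<le>D. real i * w i * z ^ i) \<longleftrightarrow> h z = 0" for z
    by (auto simp: h_def algebra_simps sum_subtractf)
  show ?thesis unfolding iff
  proof (rule ex1I[of _ x])
    fix z assume "0 < z \<and> h z = 0"
    then show "z = x"
      using mono[of z x] mono[of x z] x by (cases z x rule: linorder_cases) auto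
  qed (use x \<open>x \<noteq> 0\<close> in auto)
qed

lemma r_pos: "r > 0" and r_critical: "(\<Sum>i\<le>D. real i * w i * r ^ i) = phi r"
  using theI'[OF r_unique] unfolding r_def phi_def by auto

lemma phi_pos: "x \<ge> 0 \<Longrightarrow> phi x > 0"
proof -
  assume "x \<ge> 0"
  then have "0 < w 0 * x ^ 0" using w by simp
  also have "\<dots> \<le> phi x"
    unfolding phi_def using \<open>x \<ge> 0\<close> w
    by (intro member_le_sum) (auto simp: less_imp_le intro!: mult_nonneg_nonneg)
  finally show ?thesis .
qed

lemma s_pos: "s > 0"
  using r_pos phi_pos by (simp add: s_def)

text \<open>By \<open>r_critical\<close> the tangent to \<open>phi\<close> at \<open>r\<close>
  passes through the origin, and \<open>phi\<close> lies above it by convexity, here Bernoulli's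
  inequality for \<open>(x / r) ^ i\<close>.\<close>

lemma phi_tangent: "x \<ge> 0 \<Longrightarrow> x \<le> s * phi x"
proof -
  assume x: "x \<ge> 0"
  have "phi r * x / r = (\<Sum>i\<le>D. w i * r ^ i * (1 + real i * (x / r - 1)))"
  proof -
    have "(\<Sum>i\<le>D. w i * r ^ i * (1 + real i * c)) = phi r + c * phi r" for c
    proof -
      have "(\<Sum>i\<le>D. w i * r ^ i * (1 + real i * c)) = phi r + c * (\<Sum>i\<le>D. real i * w i * r ^ i)"
        by (simp add: phi_def distrib_left sum.distrib sum_distrib_left mult_ac)
      then show ?thesis unfolding r_critical .
    qed
    from this[of "x / r - 1"] show ?thesis by (simp only:) (simp add: algebra_simps)
  qed
  also have "\<dots> \<le> (\<Sum>i\<le>D. w i * r ^ i * (x / r) ^ i)"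
  proof (intro sum_mono mult_left_mono)
    fix i
    show "1 + real i * (x / r - 1) \<le> (x / r) ^ i"
      using Bernoulli_inequality[of "x / r - 1" i] x r_pos by simp
    show "0 \<le> w i * r ^ i" using w[of i] r_pos by simp
  qed
  also have "\<dots> = phi x"
    using r_pos by (simp add: phi_def power_divide)
  finally show ?thesis
    using r_pos phi_pos[of r] by (simp add: s_def field_simps)
qed

section \<open>Coefficients of powers of \<open>W\<close>\<close>

lemma W_nth: "W $ i = (if i \<le> D then w i else 0)"
  by (simp add: W_def)

lemma W_nonneg: "W $ i \<ge> 0"
  using w by (simp add: W_nth less_imp_le)

lemma W_power_pos: "m \<le> N \<Longrightarrow> (W ^ N) $ m > 0"
proof (induction N arbitrary: m)
  case (Suc N)
  \<comment> \<open>Degrees 0 and 1 suffice: the factor split off has degree 1 only if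
    \<open>m = Suc N\<close>.\<close>
  define i where "i = (if m \<le> N then 0 else 1 :: nat)"
  have i: "i \<le> m" "m - i \<le> N" "i \<le> D" using Suc.prems D by (auto simp: i_def)
  have "0 < W $ i * (W ^ N) $ (m - i)"
    using Suc.IH[OF i(2)] w i by (simp add: W_nth)
  also have "\<dots> \<le> (W ^ Suc N) $ m"
    unfolding power_Suc fps_mult_nth
    by (rule member_le_sum) (use i in \<open>auto simp: W_nonneg fps_power_nonneg\<close>)
  finally show ?case .
qed simp

lemma W_power_bound: "(W ^ N) $ m * r ^ m \<le> phi r ^ N"
proof -
  have "(\<Sum>i\<le>D. W $ i * r ^ i) = phi r" by (simp add: phi_def W_nth)
  then show ?thesis
    using fps_power_nth_bound[of W D r N m] W_nonneg r_pos by (simp add: W_nth)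
qed

text \<open>For independent letters \<open>j\<close> with probabilities
  \<open>w j * r ^ j / phi r\<close>, \<open>p\<close> is the probability of the letter
  \<open>i\<close>, and \<open>q\<close> is its expected frequency in a word of length
  \<open>N\<close> given the sum \<open>m\<close>. Jensen's lower bound and Chernoff's upper bound
  for a coefficient of \<open>V ^ N\<close> are compared, where \<open>V\<close> tilts the weight of
  \<open>i\<close> by \<open>exp t\<close>. The last term measures the exponential decay of the
  untilted coefficient.\<close>

lemma W_power_tilted_bound:
  assumes i: "i \<le> D" "i \<le> m" "N > 0"
  defines "p \<equiv> w i * r ^ i / phi r" and "q \<equiv> w i * (W ^ (N - 1)) $ (m - i) / (W ^ N) $ m"
  assumes pos: "(W ^ N) $ m > 0"
  shows "t * q \<le> ln (1 - p + exp t * p) - ln ((W ^ N) $ m * r ^ m / phi r ^ N) / real N"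
proof -
  define u where "u = fps_const (w i) * fps_X ^ i"
  define V where "V = W + fps_const (exp t - 1) * u"
  have u_nth: "u $ n = (if n = i then w i else 0)" for n
    by (simp add: u_def fps_X_power_nth)
  have u: "u $ n \<ge> 0" "(W - u) $ n \<ge> 0" for n
    using w[of i] i W_nonneg[of n] by (auto simp: u_nth W_nth)
  have V: "V $ n \<ge> 0" for n
  proof -
    have "V = (W - u) + fps_const (exp t) * u" by (simp add: V_def algebra_simps flip: fps_const_sub)
    then show ?thesis using u by simp
  qed
  have phi: "phi r > 0" using phi_pos r_pos by simp
  have SV: "(\<Sum>j\<le>D. V $ j * r ^ j) = phi r * (1 - p + exp t * p)"
  proof -
    have "V $ j * r ^ j = w j * r ^ j + (if j = i then (exp t - 1) * w i * r ^ i else 0)" if "j \<le> D" for j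
      using that by (simp add: V_def u_nth W_nth algebra_simps)
    then have "(\<Sum>j\<le>D. V $ j * r ^ j) = phi r + (exp t - 1) * w i * r ^ i"
      using i by (simp add: sum.distrib phi_def)
    moreover have "phi r * p = w i * r ^ i" using phi by (simp add: p_def)
    then have "phi r * (1 - p + exp t * p) = phi r + (exp t - 1) * w i * r ^ i"
      by (simp add: algebra_simps)
    ultimately show ?thesis by simp
  qed
  have p: "0 < p" "p \<le> 1"
  proof -
    have "w i * r ^ i \<le> phi r"
      unfolding phi_def using i w r_pos by (intro member_le_sum) (auto simp: less_imp_le)
    then show "0 < p" "p \<le> 1" using w[of i] r_pos phi by (auto simp: p_def)
  qed
  have pt: "1 - p + exp t * p > 0"
    using p by (simp add: add_nonneg_pos)
  have uW: "(u * W ^ (N - 1)) $ m = w i * (W ^ (N - 1)) $ (m - i)"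
    using i by (simp add: u_def mult.assoc fps_X_power_mult_nth)
  \<comment> \<open>With the tangent taken at the mean number \<open>N * q\<close> of marks, the
    linear terms cancel.\<close>
  have "exp (t * (real N * q)) * (W ^ N) $ m =
     exp (t * (real N * q)) * ((1 - t * (real N * q)) * (W ^ N) $ m + t * real N * (u * W ^ (N - 1)) $ m)"
    using pos by (simp only: uW) (simp add: q_def field_simps)
  also have "\<dots> \<le> (V ^ N) $ m"
    unfolding V_def by (rule fps_power_exp_moment) (use u in auto)
  finally have "exp (t * (real N * q)) * (W ^ N) $ m * r ^ m \<le> (V ^ N) $ m * r ^ m"
    using r_pos by simp
  also have "\<dots> \<le> (phi r * (1 - p + exp t * p)) ^ N"
    unfolding SV[symmetric]
    by (rule fps_power_nth_bound) (use V r_pos i in \<open>auto simp: V_def u_nth W_nth\<close>)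
  finally have "exp (t * (real N * q)) * ((W ^ N) $ m * r ^ m / phi r ^ N) \<le> (1 - p + exp t * p) ^ N"
    using phi by (simp add: power_mult_distrib pos_divide_le_eq mult_ac)
  then have "ln (exp (t * (real N * q)) * ((W ^ N) $ m * r ^ m / phi r ^ N)) \<le> ln ((1 - p + exp t * p) ^ N)"
    using pos phi r_pos by (intro ln_mono) auto
  also have "ln (exp (t * (real N * q)) * ((W ^ N) $ m * r ^ m / phi r ^ N)) =
      t * (real N * q) + ln ((W ^ N) $ m * r ^ m / phi r ^ N)"
    using pos phi r_pos by (subst ln_mult_pos) auto
  also have "ln ((1 - p + exp t * p) ^ N) = real N * ln (1 - p + exp t * p)"
    using pt by (simp add: ln_realpow)
  finally have "t * (real N * q) + ln ((W ^ N) $ m * r ^ m / phi r ^ N) \<le> real N * ln (1 - p + exp t * p)" .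
  then show ?thesis using i(3) by (simp add: field_simps)
qed

section \<open>Ratio limits near the diagonal\<close>

text \<open>For \<open>k \<ge> 1\<close> this is \<open>Z k (n + k)\<close> up to the factor
  \<open>k / (n + k)\<close>, by the Otter-Dwass formula.\<close>

definition g :: "nat \<Rightarrow> nat \<Rightarrow> real" where
  "g k n = (W ^ (n + k)) $ n"

lemma g_pos: "g k n > 0"
  by (simp add: g_def W_power_pos)

text \<open>Dropping one letter \<open>i\<close> from a word of length \<open>n + i + k\<close> and
  sum \<open>n + i\<close> leaves length \<open>n + i + k - 1\<close> and sum \<open>n\<close>, so
  that \<open>w i\<close> times the quotient is a conditional letter frequency. The hypothesis on
  ratios excludes exponential decay; hence the frequency tends to the unconditional probability
  \<open>p\<close>.\<close>

lemma g_step_limit: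
  assumes k: "k \<ge> 1" and i: "i \<le> D" and lim: "(\<lambda>n. g k n / g k (Suc n)) \<longlonglongrightarrow> s"
  shows "(\<lambda>n. g (k + i - 1) n / g k (n + i)) \<longlonglongrightarrow> r ^ i / phi r"
proof -
  have phi: "phi r > 0" using phi_pos r_pos by simp
  define p where "p = w i * r ^ i / phi r"
  define x where "x n = ln (g k n * r ^ n / phi r ^ (n + k))" for n
  \<comment> \<open>Reindexing by the exponent \<open>N = n + k\<close>; the truncated subtraction
    affects only \<open>N < k\<close>.\<close>
  define y where "y N = x (N - k)" for N
  have "x (Suc n) - x n = - ln (g k n / g k (Suc n) / s)" for n
  proof -
    have eq: "g k (Suc n) * r ^ Suc n / phi r ^ (Suc n + k) =
        (g k n * r ^ n / phi r ^ (n + k)) * inverse (g k n / g k (Suc n) / s)"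
      using g_pos[of k n] g_pos[of k "Suc n"] r_pos phi by (simp add: s_def field_simps)
    have "x (Suc n) = x n + ln (inverse (g k n / g k (Suc n) / s))"
      unfolding x_def eq
      by (rule ln_mult_pos) (use g_pos[of k n] g_pos[of k "Suc n"] r_pos phi s_pos in auto)
    also have "ln (inverse (g k n / g k (Suc n) / s)) = - ln (g k n / g k (Suc n) / s)"
      by (rule ln_inverse)
    finally show ?thesis by simp
  qed
  moreover have "(\<lambda>n. - ln (g k n / g k (Suc n) / s)) \<longlonglongrightarrow> - ln (s / s)"
    using s_pos by (intro tendsto_intros lim) auto
  ultimately have "(\<lambda>n. y (Suc (n + k)) - y (n + k)) \<longlonglongrightarrow> 0"
    using s_pos by (simp add: y_def Suc_diff_le)
  then have "(\<lambda>N. y (Suc N) - y N) \<longlonglongrightarrow> 0"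
    by (rule LIMSEQ_offset)
  then have "(\<lambda>N. y N / real N) \<longlonglongrightarrow> 0"
    by (rule LIMSEQ_div_of_differences)
  then have "(\<lambda>n. y (n + (i + k)) / real (n + (i + k))) \<longlonglongrightarrow> 0"
    by (rule LIMSEQ_ignore_initial_segment)
  then have e: "(\<lambda>n. - (x (n + i) / real (n + (i + k)))) \<longlonglongrightarrow> 0"
    using tendsto_minus by (fastforce simp: y_def)
  have "(\<lambda>n. w i * g (k + i - 1) n / g k (n + i)) \<longlonglongrightarrow> p"
  \<comment> \<open>Here \<open>h t = ln (1 - p + exp t * p)\<close>, the cumulant generating
    function of a single mark, whose derivative at 0 is \<open>p\<close>.\<close>
  proof (rule tendsto_of_linear_bounds[OF _ e])
    fix t
    show "\<forall>\<^sub>F n in sequentially. t * (w i * g (k + i - 1) n / g k (n + i))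
        \<le> ln (1 - p + exp t * p) + - (x (n + i) / real (n + (i + k)))"
    proof (rule always_eventually, rule allI)
      fix n
      show "t * (w i * g (k + i - 1) n / g k (n + i))
        \<le> ln (1 - p + exp t * p) + - (x (n + i) / real (n + (i + k)))"
        using W_power_tilted_bound[of i "n + i" "n + i + k" t] i k W_power_pos[of "n + i" "n + i + k"]
        by (simp add: g_def x_def p_def add_ac)
    qed
    show "ln (1 - p + exp 0 * p) = 0" by simp
    show "((\<lambda>t. ln (1 - p + exp t * p)) has_real_derivative p) (at 0)"
      by (auto intro!: derivative_eq_intros)
  qed
  then have "(\<lambda>n. w i * g (k + i - 1) n / g k (n + i) / w i) \<longlonglongrightarrow> p / w i"
    using w[of i] by (intro tendsto_intros) auto
  then show ?thesis
    using w[of i] by (simp add: p_def field_simps)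
qed

text \<open>The letter 2 raises the first index of \<open>g\<close> by one, as
  \<open>k + 2 - 1 = k + 1\<close>. Both limits are carried along because
  \<open>g_step_limit\<close> requires the first one at each index.\<close>

lemma g_ratio_limits:
  assumes lim: "(\<lambda>n. g 1 n / g 1 (Suc n)) \<longlonglongrightarrow> s"
  shows "(\<lambda>n. g (Suc k) n / g (Suc k) (Suc n)) \<longlonglongrightarrow> s \<and> (\<lambda>n. g (Suc k) n / g 1 n) \<longlonglongrightarrow> phi r ^ k"
proof (induction k)
  case 0
  have "g 1 n / g 1 n = 1" for n using g_pos[of 1 n] by simp
  then show ?case using lim by simp
next
  case (Suc k)
  have phi: "phi r > 0" using phi_pos r_pos by simp
  let ?k = "Suc k"
  have lim_k: "(\<lambda>n. g ?k n / g ?k (Suc n)) \<longlonglongrightarrow> s" and lim_1: "(\<lambda>n. g ?k n / g 1 n) \<longlonglongrightarrow> phi r ^ k"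
    using Suc by auto
  have "(\<lambda>n. g (Suc ?k) n / g ?k (n + 2)) \<longlonglongrightarrow> r ^ 2 / phi r"
    using g_step_limit[OF _ D lim_k] by (simp add: numeral_2_eq_2)
  from tendsto_divide[OF this tendsto_mult[OF lim_k LIMSEQ_Suc[OF lim_k]]]
  have "(\<lambda>n. g (Suc ?k) n / g ?k (n + 2) / ((g ?k n / g ?k (Suc n)) *
       (g ?k (Suc n) / g ?k (Suc (Suc n))))) \<longlonglongrightarrow> r ^ 2 / phi r / (s * s)"
    using s_pos by simp
  moreover have "r ^ 2 / phi r / (s * s) = phi r"
    using phi r_pos by (simp add: s_def field_simps power2_eq_square)
  moreover have "g (Suc ?k) n / g ?k (n + 2) / ((g ?k n / g ?k (Suc n)) *
       (g ?k (Suc n) / g ?k (Suc (Suc n)))) = g (Suc ?k) n / g ?k n" for n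
    using g_pos[of ?k "Suc n"] g_pos[of ?k "n + 2"] by (simp add: field_simps)
  ultimately have step: "(\<lambda>n. g (Suc ?k) n / g ?k n) \<longlonglongrightarrow> phi r"
    by simp
  have "(\<lambda>n. (g (Suc ?k) n / g ?k n) * (g ?k n / g 1 n)) \<longlonglongrightarrow> phi r * phi r ^ k"
    by (intro tendsto_intros step lim_1)
  moreover have "(g (Suc ?k) n / g ?k n) * (g ?k n / g 1 n) = g (Suc ?k) n / g 1 n" for n
    using g_pos[of ?k n] by (simp add: field_simps)
  ultimately have 1: "(\<lambda>n. g (Suc ?k) n / g 1 n) \<longlonglongrightarrow> phi r ^ ?k"
    by (simp only: power_Suc)
  \<comment> \<open>The ratio at the new index is the old one times a quotient of consecutive terms
    of a sequence tending to \<open>phi r\<close>.\<close>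
  from tendsto_divide[OF tendsto_mult[OF step lim_k] LIMSEQ_Suc[OF step]]
  have "(\<lambda>n. (g (Suc ?k) n / g ?k n) * (g ?k n / g ?k (Suc n)) / (g (Suc ?k) (Suc n) / g ?k (Suc n)))
      \<longlonglongrightarrow> phi r * s / phi r"
    using phi by simp
  moreover have "(g (Suc ?k) n / g ?k n) * (g ?k n / g ?k (Suc n)) / (g (Suc ?k) (Suc n) / g ?k (Suc n))
      = g (Suc ?k) n / g (Suc ?k) (Suc n)" for n
    using g_pos[of ?k n] g_pos[of ?k "Suc n"] by (simp add: field_simps)
  ultimately have "(\<lambda>n. g (Suc ?k) n / g (Suc ?k) (Suc n)) \<longlonglongrightarrow> phi r * s / phi r"
    by (simp only:)
  then show ?case using 1 phi by simp
qed

end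

section \<open>Plane forests\<close>

lemma vertices_Node: "vertices (Node cs) = insert [] (\<Union>i<length cs. (#) i ` vertices (cs ! i))"
proof (intro set_eqI iffI)
  fix v assume "v \<in> vertices (Node cs)"
  then show "v \<in> insert [] (\<Union>i<length cs. (#) i ` vertices (cs ! i))"
    by (cases v) (auto simp: vertices_def)
qed (auto simp: vertices_def)

lemma finite_vertices_Node: "finite (vertices (Node cs)) \<longleftrightarrow> (\<forall>t\<in>set cs. finite (vertices t))"
  by (auto simp: vertices_Node all_set_conv_all_nth finite_image_iff)

lemma branching_Node [simp]:
  "branching (Node cs) [] = length cs" "branching (Node cs) (i # v) = branching (cs ! i) v"
  by (simp_all add: branching_def)

lemma Node_in_bounded_trees_iff:
  "Node cs \<in> bounded_trees D \<longleftrightarrow> length cs \<le> D \<and> set cs \<subseteq> bounded_trees D"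
  by (auto simp: bounded_trees_def vertices_Node set_conv_nth)

text \<open>Stated for any commutative monoid, so as to yield both the additive recursion for the
  number of vertices and the multiplicative one for the weight.\<close>

lemma (in comm_monoid_set) over_vertices_Node:
  assumes "\<forall>t\<in>set cs. finite (vertices t)"
  shows "F h (vertices (Node cs)) =
    h [] \<^bold>* F (\<lambda>i. F (\<lambda>v. h (i # v)) (vertices (cs ! i))) {0..<length cs}"
proof -
  have fin: "finite (vertices (cs ! i))" if "i < length cs" for i
    using assms that by auto
  have "F h (\<Union>i\<in>{0..<length cs}. (#) i ` vertices (cs ! i)) =
      F (\<lambda>i. F h ((#) i ` vertices (cs ! i))) {0..<length cs}"
    by (rule UNION_disjoint) (use fin in auto)
  also have "\<dots> = F (\<lambda>i. F (\<lambda>v. h (i # v)) (vertices (cs ! i))) {0..<length cs}"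
    by (rule cong[OF refl], subst reindex) (auto simp: o_def)
  finally show ?thesis
    unfolding vertices_Node atLeast0LessThan
    by (subst insert) (use fin in auto)
qed


definition finite_trees :: "nat \<Rightarrow> plane_tree set" where
  "finite_trees D = {t \<in> bounded_trees D. finite (vertices t)}"

lemma Node_in_finite_trees_iff:
  "Node cs \<in> finite_trees D \<longleftrightarrow> length cs \<le> D \<and> set cs \<subseteq> finite_trees D"
  by (auto simp: finite_trees_def Node_in_bounded_trees_iff finite_vertices_Node)

lemma card_vertices_Node:
  assumes "\<forall>t\<in>set cs. finite (vertices t)"
  shows "card (vertices (Node cs)) = Suc (\<Sum>t\<leftarrow>cs. card (vertices t))"
  using sum.over_vertices_Node[OF assms, of "\<lambda>_. 1 :: nat"]
  by (simp add: sum_list_sum_nth)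

definition tree_weight :: "(nat \<Rightarrow> real) \<Rightarrow> plane_tree \<Rightarrow> real" where
  "tree_weight w t = (\<Prod>v\<in>vertices t. w (branching t v))"

lemma tree_weight_Node:
  assumes "\<forall>t\<in>set cs. finite (vertices t)"
  shows "tree_weight w (Node cs) = w (length cs) * (\<Prod>t\<leftarrow>cs. tree_weight w t)"
  unfolding tree_weight_def prod.over_vertices_Node[OF assms]
  by (simp add: prod.list_conv_set_nth)

lemma level_size_0 [simp]: "level_size 0 t = 1"
proof -
  have "{v \<in> vertices t. length v = 0} = {[]}" by (auto simp: vertices_def)
  then show ?thesis by (simp add: level_size_def)
qed

lemma level_vertices_Suc:
  "{v \<in> vertices (Node cs). length v = Suc n} =
    (\<Union>i<length cs. (#) i ` {v \<in> vertices (cs ! i). length v = n})"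
  by (auto simp: vertices_Node)

lemma finite_level_vertices: "finite {v \<in> vertices t. length v = n}"
proof (induction n arbitrary: t)
  case 0
  have "{v \<in> vertices t. length v = 0} = {[]}" by (auto simp: vertices_def)
  then show ?case by simp
next
  case (Suc n)
  then show ?case by (cases t) (simp only: level_vertices_Suc, auto)
qed

lemma level_size_Suc: "level_size (Suc n) (Node cs) = (\<Sum>t\<leftarrow>cs. level_size n t)"
proof -
  have "level_size (Suc n) (Node cs) =
      (\<Sum>i<length cs. card ((#) i ` {v \<in> vertices (cs ! i). length v = n}))"
    unfolding level_size_def level_vertices_Suc
    by (rule card_UN_disjoint) (auto simp: finite_level_vertices)
  then show ?thesis
    by (simp add: card_image level_size_def sum_list_sum_nth atLeast0LessThan)
qed

section \<open>Forests and the removal of their roots\<close>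

definition finite_forests :: "nat \<Rightarrow> nat \<Rightarrow> nat \<Rightarrow> plane_tree list set" where
  "finite_forests D k N =
    {ts. length ts = k \<and> set ts \<subseteq> finite_trees D \<and> (\<Sum>t\<leftarrow>ts. card (vertices t)) = N}"

definition forest_weight :: "(nat \<Rightarrow> real) \<Rightarrow> plane_tree list \<Rightarrow> real" where
  "forest_weight w ts = (\<Prod>t\<leftarrow>ts. tree_weight w t)"

definition forest_level :: "nat \<Rightarrow> plane_tree list \<Rightarrow> nat" where
  "forest_level n ts = (\<Sum>t\<leftarrow>ts. level_size n t)"

definition root_degrees :: "plane_tree list \<Rightarrow> nat list" where
  "root_degrees ts = map (length \<circ> children) ts"

definition prune_roots :: "plane_tree list \<Rightarrow> plane_tree list" where
  "prune_roots ts = concat (map children ts)"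

text \<open>Inverse to the pair of \<open>root_degrees\<close> and \<open>prune_roots\<close>,
  provided that the degrees add up to the length of the list: the children of the roots form
  consecutive blocks.\<close>

fun add_roots :: "nat list \<Rightarrow> plane_tree list \<Rightarrow> plane_tree list" where
  "add_roots [] ts = []"
| "add_roots (i # is) ts = Node (take i ts) # add_roots is (drop i ts)"

lemma forest_level_0 [simp]: "forest_level 0 ts = length ts"
  by (simp add: forest_level_def sum_list_triv)

lemma forest_level_Suc: "forest_level (Suc n) ts = forest_level n (prune_roots ts)"
proof (induction ts)
  case (Cons t ts)
  then show ?case
    by (cases t) (simp add: forest_level_def prune_roots_def level_size_Suc)
qed (simp add: forest_level_def prune_roots_def)

lemma forest_size_prune_roots:
  assumes "\<forall>t\<in>set ts. finite (vertices t)"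
  shows "(\<Sum>t\<leftarrow>ts. card (vertices t)) = length ts + (\<Sum>t\<leftarrow>prune_roots ts. card (vertices t))"
  using assms
proof (induction ts)
  case (Cons t ts)
  then show ?case
    by (cases t) (simp add: prune_roots_def finite_vertices_Node card_vertices_Node)
qed (simp add: prune_roots_def)

lemma forest_weight_prune_roots:
  assumes "\<forall>t\<in>set ts. finite (vertices t)"
  shows "forest_weight w ts = (\<Prod>i\<leftarrow>root_degrees ts. w i) * forest_weight w (prune_roots ts)"
  using assms
proof (induction ts)
  case (Cons t ts)
  then show ?case
    by (cases t) (simp add: forest_weight_def root_degrees_def prune_roots_def
        finite_vertices_Node tree_weight_Node)
qed (simp add: forest_weight_def root_degrees_def prune_roots_def)

lemma set_in_finite_trees_prune_roots:
  "set ts \<subseteq> finite_trees D \<longleftrightarrow>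
    set (root_degrees ts) \<subseteq> {..D} \<and> set (prune_roots ts) \<subseteq> finite_trees D"
proof (induction ts)
  case (Cons t ts)
  then show ?case
    by (cases t) (auto simp: root_degrees_def prune_roots_def Node_in_finite_trees_iff)
qed (simp add: root_degrees_def prune_roots_def)

lemma length_prune_roots: "length (prune_roots ts) = sum_list (root_degrees ts)"
  by (simp add: prune_roots_def root_degrees_def length_concat o_def)

lemma add_roots_root_degrees: "add_roots (root_degrees ts) (prune_roots ts) = ts"
  by (induction ts) (auto simp: root_degrees_def prune_roots_def)

lemma root_degrees_add_roots: "sum_list is = length ts \<Longrightarrow> root_degrees (add_roots is ts) = is"
  by (induction "is" arbitrary: ts) (auto simp: root_degrees_def)

lemma prune_roots_add_roots: "sum_list is = length ts \<Longrightarrow> prune_roots (add_roots is ts) = ts"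
  by (induction "is" arbitrary: ts) (auto simp: prune_roots_def)

lemma finite_forestsD: "ts \<in> finite_forests D k N \<Longrightarrow> \<forall>t\<in>set ts. finite (vertices t)"
  by (auto simp: finite_forests_def finite_trees_def)

definition words :: "nat \<Rightarrow> nat \<Rightarrow> nat \<Rightarrow> nat list set" where
  "words D k m = {is. length is = k \<and> set is \<subseteq> {..D} \<and> sum_list is = m}"

lemma finite_words: "finite (words D k m)"
  by (rule finite_subset[OF _ finite_lists_length_eq[of "{..D}" k]]) (auto simp: words_def)

text \<open>The predicate \<open>Q\<close> on the lower forest is left free, so that one bijection
  serves for total weights and for prescribed level sizes. Writing the size as \<open>N + k\<close>
  avoids subtraction.\<close>

lemma bij_betw_add_roots:
  "bij_betw (\<lambda>(is, ts). add_roots is ts)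
    (words D k m \<times> {ts \<in> finite_forests D m N. Q ts})
    {ts \<in> finite_forests D k (N + k). length (prune_roots ts) = m \<and> Q (prune_roots ts)}"
  (is "bij_betw _ ?A ?B")
proof (rule bij_betw_byWitness[where f' = "\<lambda>ts. (root_degrees ts, prune_roots ts)"])
  have fin: "\<forall>t\<in>set ts. finite (vertices t)" if "set ts \<subseteq> finite_trees D" for ts
    using that by (auto simp: finite_trees_def)
  have len: "length (add_roots is ts) = length is" for "is" ts
    by (induction "is" arbitrary: ts) auto
  show "\<forall>a\<in>?A. (\<lambda>ts. (root_degrees ts, prune_roots ts)) ((\<lambda>(is, ts). add_roots is ts) a) = a"
    by (auto simp: words_def finite_forests_def root_degrees_add_roots prune_roots_add_roots)
  show "\<forall>ts\<in>?B. (\<lambda>(is, ts). add_roots is ts) (root_degrees ts, prune_roots ts) = ts"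
    by (simp add: add_roots_root_degrees)
  show "(\<lambda>(is, ts). add_roots is ts) ` ?A \<subseteq> ?B"
  proof clarify
    fix "is" ts assume *: "is \<in> words D k m" "ts \<in> finite_forests D m N" "Q ts"
    then have sum: "sum_list is = length ts" by (simp add: words_def finite_forests_def)
    have "set (add_roots is ts) \<subseteq> finite_trees D"
      using * sum
      by (simp add: set_in_finite_trees_prune_roots[of "add_roots is ts"] root_degrees_add_roots
          prune_roots_add_roots words_def finite_forests_def)
    then show "add_roots is ts \<in> finite_forests D k (N + k) \<and>
        length (prune_roots (add_roots is ts)) = m \<and> Q (prune_roots (add_roots is ts))"
      using * sum forest_size_prune_roots[OF fin, of "add_roots is ts"]
      by (simp add: finite_forests_def prune_roots_add_roots len words_def)
  qed
  show "(\<lambda>ts. (root_degrees ts, prune_roots ts)) ` ?B \<subseteq> ?A"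
  proof clarify
    fix ts assume *: "ts \<in> finite_forests D k (N + k)" "m = length (prune_roots ts)" "Q (prune_roots ts)"
    then show "root_degrees ts \<in> words D (k) (length (prune_roots ts)) \<and>
        prune_roots ts \<in> {xs \<in> finite_forests D (length (prune_roots ts)) N. Q xs}"
      using set_in_finite_trees_prune_roots[of ts D] forest_size_prune_roots[OF fin, of ts]
      by (auto simp: finite_forests_def words_def length_prune_roots) (auto simp: root_degrees_def)
  qed
qed

lemma length_le_forest_size:
  assumes "ts \<in> finite_forests D k N" shows "k \<le> N"
  using forest_size_prune_roots[OF finite_forestsD[OF assms]] assms
  by (simp add: finite_forests_def)

lemma length_prune_roots_le:
  assumes "ts \<in> finite_forests D k (N + k)" shows "length (prune_roots ts) \<le> N"
proof -
  have "prune_roots ts \<in> finite_forests D (length (prune_roots ts)) N"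
    using assms forest_size_prune_roots[OF finite_forestsD[OF assms]]
      set_in_finite_trees_prune_roots[of ts D]
    by (simp add: finite_forests_def)
  then show ?thesis by (rule length_le_forest_size)
qed

text \<open>Removing \<open>k > 0\<close> roots leaves fewer vertices, so that strong induction on
  \<open>N\<close> applies; there are finitely many words, and at most \<open>N - k\<close> new
  roots.\<close>

lemma finite_finite_forests: "finite (finite_forests D k N)"
proof (induction N arbitrary: k rule: less_induct)
  case (less N)
  consider "k = 0" | "k > N" | "k > 0" "k \<le> N" by linarith
  then show ?case
  proof cases
    case 1
    then have "finite_forests D k N \<subseteq> {[]}" by (auto simp: finite_forests_def)
    then show ?thesis by (rule finite_subset) simp
  next
    case 2
    then have "finite_forests D k N = {}" using length_le_forest_size[of _ D k N] by fastforce
    then show ?thesis by simp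
  next
    case 3
    define M where "M = N - k"
    have N: "N = M + k" "M < N" using 3 by (auto simp: M_def)
    have "finite {ts \<in> finite_forests D k (M + k). length (prune_roots ts) = m}" for m
      using bij_betw_finite[OF bij_betw_add_roots[of D k m M "\<lambda>_. True"]] less[OF N(2)]
      by (simp add: finite_words)
    then have "finite (\<Union>m\<le>M. {ts \<in> finite_forests D k (M + k). length (prune_roots ts) = m})"
      by simp
    then show ?thesis
      unfolding N(1) by (rule rev_finite_subset) (use length_prune_roots_le in blast)
  qed
qed

section \<open>Weighted counting of forests\<close>

context branching_weights
begin

lemma W_power_nth_words: "(W ^ k) $ m = (\<Sum>is\<in>words D k m. \<Prod>i\<leftarrow>is. w i)"
proof (induction k arbitrary: m)
  case 0
  have "words D 0 m = (if m = 0 then {[]} else {})" by (auto simp: words_def)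
  then show ?case by (simp add: fps_one_nth)
next
  case (Suc k)
  have "words D (Suc k) m = (\<Union>i\<in>{..m} \<inter> {..D}. (#) i ` words D k (m - i))"
    by (auto simp: words_def length_Suc_conv image_iff)
  then have "(\<Sum>is\<in>words D (Suc k) m. \<Prod>i\<leftarrow>is. w i) =
      (\<Sum>i\<in>{..m} \<inter> {..D}. \<Sum>is\<in>(#) i ` words D k (m - i). \<Prod>i\<leftarrow>is. w i)"
    by (simp only:) (rule sum.UNION_disjoint, auto simp: finite_words)
  also have "\<dots> = (\<Sum>i\<in>{..m} \<inter> {..D}. w i * (W ^ k) $ (m - i))"
    by (simp add: sum.reindex Suc sum_distrib_left)
  also have "\<dots> = (W ^ Suc k) $ m"
    unfolding power_Suc fps_mult_nth atLeast0AtMost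
    by (intro sum.mono_neutral_cong_left) (auto simp: W_nth)
  finally show ?case by simp
qed

text \<open>The weight factorizes along the bijection; the words contribute the coefficient of
  \<open>W ^ k\<close>, independently of the lower forest.\<close>

lemma sum_forests_prune_roots:
  "(\<Sum>ts | ts \<in> finite_forests D k (N + k) \<and> length (prune_roots ts) = m \<and> Q (prune_roots ts).
      forest_weight w ts) =
    (W ^ k) $ m * (\<Sum>ts | ts \<in> finite_forests D m N \<and> Q ts. forest_weight w ts)"
proof -
  let ?A = "words D k m \<times> {ts \<in> finite_forests D m N. Q ts}"
  have "(\<Sum>ts | ts \<in> finite_forests D k (N + k) \<and> length (prune_roots ts) = m \<and> Q (prune_roots ts).
      forest_weight w ts) = (\<Sum>(is, ts)\<in>?A. forest_weight w (add_roots is ts))"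
    using sum.reindex_bij_betw[OF bij_betw_add_roots[of D k m N Q], of "forest_weight w"]
    by (simp add: case_prod_unfold)
  also have "\<dots> = (\<Sum>(is, ts)\<in>?A. (\<Prod>i\<leftarrow>is. w i) * forest_weight w ts)"
  proof (intro sum.cong refl, clarify)
    fix "is" ts assume *: "is \<in> words D k m" "ts \<in> finite_forests D m N" "Q ts"
    then have "add_roots is ts \<in> finite_forests D k (N + k)"
      using bij_betw_add_roots[of D k m N Q] by (auto simp: bij_betw_def)
    moreover have "sum_list is = length ts" using * by (simp add: words_def finite_forests_def)
    ultimately show "forest_weight w (add_roots is ts) = (\<Prod>i\<leftarrow>is. w i) * forest_weight w ts"
      using forest_weight_prune_roots[OF finite_forestsD, of "add_roots is ts"]
      by (simp add: root_degrees_add_roots prune_roots_add_roots)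
  qed
  finally show ?thesis
    by (simp add: W_power_nth_words sum_product sum.cartesian_product)
qed

definition Z :: "nat \<Rightarrow> nat \<Rightarrow> real" where
  "Z k N = (\<Sum>ts\<in>finite_forests D k N. forest_weight w ts)"

lemma Z_eq_0: "N < k \<Longrightarrow> Z k N = 0"
  using length_le_forest_size[of _ D k N] by (fastforce simp: Z_def intro: sum.neutral)

lemma Z_0: "Z 0 N = (if N = 0 then 1 else 0)"
proof -
  have "finite_forests D 0 N = (if N = 0 then {[]} else {})" by (auto simp: finite_forests_def)
  then show ?thesis by (simp add: Z_def forest_weight_def)
qed

lemma Z_prune_roots: "Z k (N + k) = (\<Sum>m\<le>N. (W ^ k) $ m * Z m N)"
proof -
  let ?S = "\<lambda>m. {ts \<in> finite_forests D k (N + k). length (prune_roots ts) = m}"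
  have eq: "finite_forests D k (N + k) = (\<Union>m\<le>N. ?S m)"
    using length_prune_roots_le by blast
  have "Z k (N + k) = (\<Sum>m\<le>N. \<Sum>ts\<in>?S m. forest_weight w ts)"
    unfolding Z_def by (subst eq, rule sum.UNION_disjoint) (auto simp: finite_finite_forests)
  then show ?thesis
    using sum_forests_prune_roots[of k N _ "\<lambda>_. True"] by (simp add: Z_def)
qed

text \<open>Induction on the number \<open>n\<close> of non-root vertices, for all \<open>k\<close>
  at once: removing the roots leaves \<open>m\<close> new roots and \<open>n - m\<close> other
  vertices. Then \<open>fps_power_times_deriv_nth\<close> evaluates the sum over
  \<open>m\<close>.\<close>

lemma otter_dwass: "real (n + k) * Z k (n + k) = real k * (W ^ (n + k)) $ n"
proof (induction n arbitrary: k rule: less_induct)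
  case (less n)
  show ?case
  proof (cases "n = 0")
    case True
    then show ?thesis using Z_prune_roots[of k 0] by (simp add: Z_0)
  next
    case False
    \<comment> \<open>For \<open>m = 0\<close> both sides vanish, as \<open>n \<noteq> 0\<close>;
      otherwise the induction hypothesis applies to \<open>n - m < n\<close>.\<close>
    have Zm: "real n * Z m n = real m * (W ^ n) $ (n - m)" if "m \<le> n" for m
    proof (cases "m = 0")
      case True
      then show ?thesis using False by (simp add: Z_0)
    next
      case m: False
      then show ?thesis using less[of "n - m" m] that False by simp
    qed
    have "real n * Z k (n + k) = (\<Sum>m\<le>n. (W ^ k) $ m * (real n * Z m n))"
      by (simp add: Z_prune_roots sum_distrib_left mult_ac)
    also have "\<dots> = (\<Sum>m\<le>n. real m * (W ^ k) $ m * (W ^ n) $ (n - m))"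
      by (intro sum.cong refl) (simp add: Zm)
    finally have "real (n + k) * (real n * Z k (n + k)) = real k * real n * (W ^ (n + k)) $ n"
      by (simp only: fps_power_times_deriv_nth)
    then show ?thesis using False by simp
  qed
qed

text \<open>The first tree, with \<open>a\<close> vertices, is split off. Thus \<open>Z k\<close> is
  a \<open>k\<close>-fold convolution power of \<open>Z 1\<close>.\<close>

lemma Z_Suc: "Z (Suc k) N = (\<Sum>a\<le>N. Z 1 a * Z k (N - a))"
proof -
  define A where "A a = finite_forests D 1 a \<times> finite_forests D k (N - a)" for a
  let ?S = "\<lambda>a. (\<lambda>(xs, ys). xs @ ys) ` A a"
  have len: "length xs = 1" if "(xs, ys) \<in> A a" for xs ys a
    using that by (simp add: A_def finite_forests_def)
  have inj: "inj_on (\<lambda>(xs, ys). xs @ ys) (A a)" for a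
    by (rule inj_onI) (auto dest!: len)
  have hd: "card (vertices (hd ts)) = a" if "ts \<in> ?S a" for ts a
    using that by (auto simp: A_def finite_forests_def length_Suc_conv)
  have eq: "finite_forests D (Suc k) N = (\<Union>a\<le>N. ?S a)"
  proof (intro set_eqI iffI)
    fix ts assume *: "ts \<in> finite_forests D (Suc k) N"
    then obtain t ts' where ts: "ts = t # ts'" by (cases ts) (auto simp: finite_forests_def)
    with * have "([t], ts') \<in> A (card (vertices t))" "card (vertices t) \<le> N"
      by (auto simp: finite_forests_def A_def)
    with ts show "ts \<in> (\<Union>a\<le>N. ?S a)" by force
  next
    fix ts assume "ts \<in> (\<Union>a\<le>N. ?S a)"
    then obtain a xs ys where "a \<le> N" "xs \<in> finite_forests D 1 a"
      "ys \<in> finite_forests D k (N - a)" "ts = xs @ ys"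
      by (auto simp: A_def)
    then show "ts \<in> finite_forests D (Suc k) N" by (simp add: finite_forests_def)
  qed
  have "Z (Suc k) N = (\<Sum>a\<le>N. \<Sum>ts\<in>?S a. forest_weight w ts)"
    unfolding Z_def
  proof (subst eq, rule sum.UNION_disjoint)
    show "\<forall>a\<in>{..N}. finite (?S a)" by (simp add: A_def finite_finite_forests)
    show "\<forall>a\<in>{..N}. \<forall>b\<in>{..N}. a \<noteq> b \<longrightarrow> ?S a \<inter> ?S b = {}" using hd by blast
  qed simp
  also have "\<dots> = (\<Sum>a\<le>N. \<Sum>(xs, ys)\<in>A a. forest_weight w xs * forest_weight w ys)"
    by (intro sum.cong refl, subst sum.reindex[OF inj]) (simp add: forest_weight_def case_prod_unfold)
  also have "\<dots> = (\<Sum>a\<le>N. Z 1 a * Z k (N - a))"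
    by (simp add: A_def Z_def sum_product sum.cartesian_product)
  finally show ?thesis .
qed

end

section \<open>Asymptotics of partition functions\<close>

lemma LIMSEQ_n_over_n_plus: "(\<lambda>n. real n / real (n + j)) \<longlonglongrightarrow> 1"
proof -
  have "(\<lambda>n. 1 - real j / real (n + j)) \<longlonglongrightarrow> 1 - 0"
    by (intro tendsto_diff tendsto_const LIMSEQ_ignore_initial_segment[OF lim_const_over_n])
  moreover have "\<forall>\<^sub>F n in sequentially. 1 - real j / real (n + j) = real n / real (n + j)"
    using eventually_gt_at_top[of 0] by eventually_elim (simp add: field_simps)
  ultimately show ?thesis by (simp add: Lim_transform_eventually)
qed

section \<open>The radius of convergence of the generating function of trees\<close>

context branching_weights
begin

lemma Z_1_Suc: "Z 1 (Suc n) = g 1 n / real (Suc n)"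
  using otter_dwass[of n 1] by (simp add: g_def field_simps)

lemma Z_eq_g: "k \<ge> 1 \<Longrightarrow> Z k (n + k) = real k * g k n / real (n + k)"
  using otter_dwass[of n k] by (simp add: g_def field_simps)

lemma Z_nonneg: "Z k N \<ge> 0"
proof (cases "k = 0 \<or> N < k")
  case True
  then show ?thesis by (auto simp: Z_0 Z_eq_0)
next
  case False
  then show ?thesis using Z_eq_g[of k "N - k"] g_pos[of k "N - k"] by simp
qed

lemma Z_1_pos: "N \<ge> 1 \<Longrightarrow> Z 1 N > 0"
  using Z_1_Suc[of "N - 1"] g_pos[of 1 "N - 1"] by simp

text \<open>Chernoff's bound at \<open>r\<close>; it makes the radius of convergence of the series
  with coefficients \<open>Z 1 N\<close> at least \<open>s\<close>.\<close>

lemma Z_1_bound: "Z 1 N * s ^ N \<le> r"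
proof (cases N)
  case 0
  then show ?thesis using r_pos by (simp add: Z_eq_0)
next
  case (Suc n)
  have phi: "phi r > 0" using phi_pos r_pos by simp
  have "Z 1 N \<le> g 1 n"
    unfolding Suc Z_1_Suc using g_pos[of 1 n] by (simp add: field_simps)
  then have "Z 1 N * s ^ N \<le> g 1 n * s ^ N"
    using s_pos by simp
  also have "\<dots> = (g 1 n * r ^ n) * (r / phi r ^ N)"
    by (simp add: s_def Suc power_divide)
  also have "\<dots> \<le> phi r ^ N * (r / phi r ^ N)"
    using W_power_bound[of "Suc n" n] r_pos phi
    by (intro mult_right_mono) (auto simp: g_def Suc)
  finally show ?thesis using phi by simp
qed

text \<open>Iterated Cauchy products by \<open>Z_Suc\<close>; convergence is absolute because all
  terms are nonnegative.\<close>

lemma Z_sums: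
  assumes x: "x \<ge> 0" and summable: "summable (\<lambda>N. Z 1 N * x ^ N)"
  shows "(\<lambda>N. Z k N * x ^ N) sums (\<Sum>N. Z 1 N * x ^ N) ^ k"
proof (induction k)
  case 0
  have "(\<lambda>N. Z 0 N * x ^ N) sums (\<Sum>N\<in>{0}. Z 0 N * x ^ N)"
    by (rule sums_finite) (auto simp: Z_0)
  then show ?case by (simp add: Z_0)
next
  case (Suc k)
  have norm: "norm (Z j N * x ^ N) = Z j N * x ^ N" for j N
    using x by (simp add: Z_nonneg)
  have "(\<lambda>N. \<Sum>a\<le>N. (Z 1 a * x ^ a) * (Z k (N - a) * x ^ (N - a))) sums
      ((\<Sum>N. Z 1 N * x ^ N) * (\<Sum>N. Z k N * x ^ N))"
    by (rule Cauchy_product_sums) (use Suc summable in \<open>simp_all only: norm sums_summable\<close>)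
  moreover have "(\<Sum>a\<le>N. (Z 1 a * x ^ a) * (Z k (N - a) * x ^ (N - a))) = Z (Suc k) N * x ^ N" for N
    unfolding Z_Suc sum_distrib_right
  proof (intro sum.cong refl)
    fix a assume "a \<in> {..N}"
    then have "x ^ N = x ^ a * x ^ (N - a)" by (simp flip: power_add)
    then show "(Z 1 a * x ^ a) * (Z k (N - a) * x ^ (N - a)) = Z 1 a * Z k (N - a) * x ^ N"
      by simp
  qed
  ultimately show ?case using sums_unique[OF Suc] by simp
qed

text \<open>The coefficient form of \<open>S = x W(S)\<close>. The range \<open>D\<close> does not
  depend on \<open>N\<close>, so that the sum can be exchanged with the series.\<close>

lemma Z_1_rec: "Z 1 (Suc N) = (\<Sum>m\<le>D. w m * Z m N)"
proof -
  have "Z 1 (Suc N) = (\<Sum>m\<le>N. W $ m * Z m N)"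
    using Z_prune_roots[of 1 N] by simp
  also have "\<dots> = (\<Sum>m\<in>{..N} \<inter> {..D}. w m * Z m N)"
    by (rule sum.mono_neutral_cong_right) (auto simp: W_nth)
  also have "\<dots> = (\<Sum>m\<le>D. w m * Z m N)"
    by (rule sum.mono_neutral_left) (auto simp: Z_eq_0)
  finally show ?thesis .
qed

text \<open>The generating function \<open>S x\<close> of the trees solves \<open>S x = x * phi (S x)\<close>, which has no
  solution for \<open>x > s\<close> by \<open>phi_tangent\<close>.\<close>

lemma Z_1_not_summable:
  assumes x: "x > s" shows "\<not> summable (\<lambda>N. Z 1 N * x ^ N)"
proof
  assume summable: "summable (\<lambda>N. Z 1 N * x ^ N)"
  have x0: "x > 0" using x s_pos by simp
  define S where "S = (\<Sum>N. Z 1 N * x ^ N)"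
  have S: "S \<ge> 0"
    unfolding S_def using summable x0 by (intro suminf_nonneg) (auto simp: Z_nonneg)
  have "(\<lambda>N. \<Sum>m\<le>D. w m * (Z m N * x ^ N)) sums (\<Sum>m\<le>D. w m * S ^ m)"
    unfolding S_def by (intro sums_sum sums_mult Z_sums summable) (use x0 in auto)
  then have "(\<lambda>N. x * (\<Sum>m\<le>D. w m * (Z m N * x ^ N))) sums (x * phi S)"
    unfolding phi_def by (rule sums_mult)
  moreover have "x * (\<Sum>m\<le>D. w m * (Z m N * x ^ N)) = Z 1 (Suc N) * x ^ Suc N" for N
    by (simp add: Z_1_rec[simplified] sum_distrib_left sum_distrib_right mult_ac)
  ultimately have "(\<lambda>N. Z 1 (Suc N) * x ^ Suc N) sums (x * phi S)"
    by simp
  moreover have "(\<lambda>N. Z 1 (Suc N) * x ^ Suc N) sums (S - Z 1 0 * x ^ 0)"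
    unfolding S_def using summable_sums[OF summable] by (subst sums_Suc_iff) simp
  ultimately have "S = x * phi S"
    using sums_unique2 by (fastforce simp: Z_eq_0)
  also have "\<dots> > s * phi S"
    using x phi_pos[OF S] by simp
  finally show False using phi_tangent[OF S] by simp
qed

text \<open>A limit of coefficient ratios is the radius of convergence, which
  \<open>Z_1_bound\<close> and \<open>Z_1_not_summable\<close> locate at \<open>s\<close> from both
  sides.\<close>

lemma Z_1_ratio_limit:
  assumes lim: "(\<lambda>N. Z 1 N / Z 1 (Suc N)) \<longlonglongrightarrow> a"
  shows "a = s"
proof -
  have "conv_radius (Z 1) = ereal a"
  proof (rule conv_radius_ratio_limit_ereal)
    show "(\<lambda>N. ereal (norm (Z 1 N) / norm (Z 1 (Suc N)))) \<longlonglongrightarrow> ereal a"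
      using lim by (simp add: Z_nonneg)
    show "\<forall>\<^sub>F N in sequentially. Z 1 N \<noteq> 0"
      using eventually_ge_at_top[of 1] by eventually_elim (use Z_1_pos in fastforce)
  qed
  moreover have "conv_radius (Z 1) = ereal s"
  proof (rule conv_radius_eqI')
    show "ereal s \<ge> 0" using s_pos by simp
    fix x :: real
    {
      assume x: "0 < x" "ereal x < ereal s"
      show "summable (\<lambda>N. Z 1 N * of_real x ^ N)"
      proof (rule summable_comparison_test')
        show "summable (\<lambda>N. r * (x / s) ^ N)"
          using x s_pos by (intro summable_mult summable_geometric) simp
        fix N
        have "Z 1 N * x ^ N = (Z 1 N * s ^ N) * (x / s) ^ N"
          using s_pos by (simp add: power_divide)
        also have "\<dots> \<le> r * (x / s) ^ N"
          using x s_pos by (intro mult_right_mono Z_1_bound) auto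
        finally show "norm (Z 1 N * of_real x ^ N) \<le> r * (x / s) ^ N"
          using x by (simp add: Z_nonneg)
      qed
    }
    {
      assume x: "0 < x" "ereal x > ereal s"
      then show "\<not> summable (\<lambda>N. norm (Z 1 N * of_real x ^ N))"
        using Z_1_not_summable[of x] by (simp add: Z_nonneg)
    }
  qed
  ultimately show ?thesis by simp
qed

section \<open>Ratio limits of partition functions\<close>

context
  assumes lim: "(\<lambda>N. Z 1 N / Z 1 (Suc N)) \<longlonglongrightarrow> s"
begin

lemma g_1_ratio: "(\<lambda>n. g 1 n / g 1 (Suc n)) \<longlonglongrightarrow> s"
proof -
  have "(\<lambda>n. Z 1 (Suc n) / Z 1 (Suc (Suc n)) * (real (Suc n) / real (Suc (Suc n)))) \<longlonglongrightarrow> s * 1"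
    by (intro tendsto_mult LIMSEQ_Suc[OF lim] LIMSEQ_Suc[OF LIMSEQ_n_over_Suc_n])
  moreover have "Z 1 (Suc n) / Z 1 (Suc (Suc n)) * (real (Suc n) / real (Suc (Suc n))) = g 1 n / g 1 (Suc n)" for n
  proof -
    have "x / p / (y / q) * (p / q) = x / y" if "p > 0" "q > 0" for x y p q :: real
      using that by simp
    then show ?thesis unfolding Z_1_Suc by simp
  qed
  ultimately show ?thesis by simp
qed

lemma Z_1_shift_ratio: "(\<lambda>N. Z 1 N / Z 1 (N + M)) \<longlonglongrightarrow> s ^ M"
proof (induction M)
  case 0
  have "\<forall>\<^sub>F N in sequentially. 1 = Z 1 N / Z 1 (N + 0)"
    using eventually_ge_at_top[of 1] by eventually_elim (use Z_1_pos in fastforce)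
  then show ?case by (auto intro: Lim_transform_eventually)
next
  case (Suc M)
  have "(\<lambda>N. (Z 1 N / Z 1 (N + M)) * (Z 1 (N + M) / Z 1 (Suc (N + M)))) \<longlonglongrightarrow> s ^ M * s"
    by (intro tendsto_mult Suc LIMSEQ_ignore_initial_segment[OF lim])
  moreover have "\<forall>\<^sub>F N in sequentially.
      (Z 1 N / Z 1 (N + M)) * (Z 1 (N + M) / Z 1 (Suc (N + M))) = Z 1 N / Z 1 (N + Suc M)"
    using eventually_ge_at_top[of 1]
  proof eventually_elim
    case (elim N)
    then show ?case using Z_1_pos[of "N + M"] by simp
  qed
  ultimately show ?case by (simp add: mult.commute Lim_transform_eventually)
qed

text \<open>With \<open>j = k - 1\<close>, the limits for \<open>g\<close> give
  \<open>k * phi r ^ j * s ^ (j + M)\<close>, where \<open>s ^ j\<close> accounts for the shift from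
  size \<open>n + 1\<close> to \<open>n + k\<close>; and \<open>phi r * s = r\<close>.\<close>

lemma Z_ratio: "(\<lambda>N. Z k N / Z 1 (N + M)) \<longlonglongrightarrow> real k * r ^ (k - 1) * s ^ M"
proof (cases k)
  case 0
  have "\<forall>\<^sub>F N in sequentially. 0 = Z k N / Z 1 (N + M)"
    using eventually_gt_at_top[of 0] by eventually_elim (simp add: 0 Z_0)
  then show ?thesis using 0 by (auto intro: Lim_transform_eventually)
next
  case (Suc j)
  have phi: "phi r > 0" using phi_pos r_pos by simp
  have "(\<lambda>n. real k * (g k n / g 1 n) * (real (Suc n) / real (n + k))
      * (Z 1 (Suc n) / Z 1 (Suc n + (j + M)))) \<longlonglongrightarrow> real k * phi r ^ j * 1 * s ^ (j + M)"
  proof (intro tendsto_mult tendsto_const)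
    show "(\<lambda>n. g k n / g 1 n) \<longlonglongrightarrow> phi r ^ j"
      using g_ratio_limits[OF g_1_ratio, of j] by (simp add: Suc)
    show "(\<lambda>n. real (Suc n) / real (n + k)) \<longlonglongrightarrow> 1"
      using LIMSEQ_Suc[OF LIMSEQ_n_over_n_plus[of j]] by (simp add: Suc)
    show "(\<lambda>n. Z 1 (Suc n) / Z 1 (Suc n + (j + M))) \<longlonglongrightarrow> s ^ (j + M)"
      by (rule LIMSEQ_Suc[OF Z_1_shift_ratio])
  qed
  moreover have "real k * (g k n / g 1 n) * (real (Suc n) / real (n + k))
      * (Z 1 (Suc n) / Z 1 (Suc n + (j + M))) = Z k (n + k) / Z 1 ((n + k) + M)" for n
    using Z_eq_g[of k n] g_pos[of 1 n] by (simp add: Suc Z_1_Suc[simplified] add_ac)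
  moreover have "real k * phi r ^ j * 1 * s ^ (j + M) = real k * r ^ (k - 1) * s ^ M"
    using phi by (simp add: Suc s_def power_add power_divide)
  ultimately have "(\<lambda>n. Z k (n + k) / Z 1 ((n + k) + M)) \<longlonglongrightarrow> real k * r ^ (k - 1) * s ^ M"
    by (simp only:)
  then show ?thesis by (rule LIMSEQ_offset)
qed

end

section \<open>Forests with prescribed level sizes\<close>

definition level_profile :: "nat \<Rightarrow> plane_tree list \<Rightarrow> nat list" where
  "level_profile n ts = map (\<lambda>i. forest_level i ts) [0..<Suc n]"

lemma level_profile_0: "level_profile 0 ts = [length ts]"
  by (simp add: level_profile_def)

lemma level_profile_Suc: "level_profile (Suc n) ts = length ts # level_profile n (prune_roots ts)"
  by (simp add: level_profile_def upt_conv_Cons map_Suc_upt[symmetric] forest_level_Suc del: upt_Suc)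

text \<open>The total weight of the ways to distribute each level as children over the preceding
  one; the default 1 is the empty product.\<close>

fun profile_weight :: "nat list \<Rightarrow> real" where
  "profile_weight (k # m # ks) = (W ^ k) $ m * profile_weight (m # ks)"
| "profile_weight _ = 1"

text \<open>Roots are removed once for each entry of \<open>ks\<close>. \<open>N\<close> counts the
  vertices of height at least \<open>length ks\<close>, and the sum over \<open>butlast\<close>
  those of smaller height.\<close>

lemma sum_forests_level_profile:
  "(\<Sum>ts | ts \<in> finite_forests D k (N + sum_list (butlast (k # ks))) \<and>
      level_profile (length ks) ts = k # ks. forest_weight w ts) =
    profile_weight (k # ks) * Z (last (k # ks)) N"
proof (induction ks arbitrary: k)
  case Nil
  have "{ts \<in> finite_forests D k N. length ts = k} = finite_forests D k N"
    by (auto simp: finite_forests_def)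
  then show ?case by (simp add: level_profile_0 Z_def)
next
  case (Cons m ks)
  let ?M = "N + sum_list (butlast (m # ks))"
  \<comment> \<open>The head of a profile is the number of roots, so the length condition in
    \<open>sum_forests_prune_roots\<close> is implied.\<close>
  have "length (prune_roots ts) = m" if "level_profile (length ks) (prune_roots ts) = m # ks" for ts
    using that by (simp add: level_profile_def upt_conv_Cons del: upt_Suc)
  then have "{ts. ts \<in> finite_forests D k (N + sum_list (butlast (k # m # ks))) \<and>
      level_profile (length (m # ks)) ts = k # m # ks} =
     {ts. ts \<in> finite_forests D k (?M + k) \<and> length (prune_roots ts) = m \<and>
       level_profile (length ks) (prune_roots ts) = m # ks}"
    by (auto simp: level_profile_Suc finite_forests_def add_ac)
  then show ?case
    using sum_forests_prune_roots[of k ?M m "\<lambda>ts. level_profile (length ks) ts = m # ks"]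
    by (simp only: Cons.IH) (simp add: mult.assoc)
qed

lemma profile_weight_snoc:
  "ks \<noteq> [] \<Longrightarrow> profile_weight (ks @ [m]) = profile_weight ks * (W ^ last ks) $ m"
  by (induction ks rule: profile_weight.induct) auto

end

section \<open>The limit law\<close>

text \<open>Relative entropy is nonnegative, by \<open>ln x \<le> x - 1\<close> at
  \<open>x = q i / p i\<close>.\<close>

lemma gibbs_inequality:
  fixes p q :: "'a \<Rightarrow> real"
  assumes "\<And>i. i \<in> I \<Longrightarrow> p i \<ge> 0" "\<And>i. i \<in> I \<Longrightarrow> q i > 0" "sum p I = sum q I"
  shows "(\<Sum>i\<in>I. p i * ln (q i)) \<le> (\<Sum>i\<in>I. p i * ln (p i))"
proof -
  have "p i * ln (q i) - p i * ln (p i) \<le> q i - p i" if "i \<in> I" for i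
  proof (cases "p i = 0")
    case False
    then have p: "p i > 0" using assms(1)[OF that] by simp
    have q: "q i > 0" using assms(2)[OF that] .
    have "p i * (ln (q i) - ln (p i)) = p i * ln (q i / p i)"
      using p q by (simp add: ln_div)
    also have "\<dots> \<le> p i * (q i / p i - 1)"
      using p q by (intro mult_left_mono ln_le_minus_one) auto
    finally show ?thesis using p by (simp add: algebra_simps)
  qed (use assms(2)[OF that] in simp)
  then have "(\<Sum>i\<in>I. p i * ln (q i) - p i * ln (p i)) \<le> (\<Sum>i\<in>I. q i - p i)"
    by (rule sum_mono)
  then show ?thesis using assms(3) by (simp add: sum_subtractf)
qed

lemma prob_diff_le_tv_dist:
  "\<bar>measure_pmf.prob p A - measure_pmf.prob q A\<bar> \<le> tv_dist p q"
  unfolding tv_dist_def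
proof (rule cSUP_upper)
  have "\<bar>measure_pmf.prob p A - measure_pmf.prob q A\<bar> \<le> 1" for A
    using measure_pmf.prob_le_1[of p A] measure_pmf.prob_le_1[of q A]
      measure_nonneg[of p A] measure_nonneg[of q A] by linarith
  then show "bdd_above (range (\<lambda>A. \<bar>measure_pmf.prob p A - measure_pmf.prob q A\<bar>))"
    by (intro bdd_aboveI2)
qed simp

lemma level_size_trunc: "i \<le> n \<Longrightarrow> level_size i (trunc n t) = level_size i t"
  unfolding level_size_def vertices_trunc by (rule arg_cong[where f = card]) auto

lemma level_size_le:
  assumes "t \<in> bounded_trees D" shows "level_size n t \<le> D ^ n"
  using assms
proof (induction n arbitrary: t)
  case (Suc n)
  obtain cs where t: "t = Node cs" by (cases t)
  have cs: "length cs \<le> D" "\<And>c. c \<in> set cs \<Longrightarrow> level_size n c \<le> D ^ n"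
    using Suc t by (auto simp: Node_in_bounded_trees_iff)
  have "level_size (Suc n) t = (\<Sum>c\<leftarrow>cs. level_size n c)"
    by (simp add: t level_size_Suc)
  also have "\<dots> \<le> (\<Sum>c\<leftarrow>cs. D ^ n)"
    by (intro sum_list_mono cs)
  also have "\<dots> \<le> D ^ Suc n"
    using cs(1) by (simp add: sum_list_triv)
  finally show ?case .
qed simp

text \<open>By induction, a truncation at \<open>Suc n\<close> is a list of at most \<open>D\<close>
  truncations at \<open>n\<close>. The finite range reduces measurability of \<open>trunc n\<close>
  to preimages of single trees.\<close>

lemma finite_trunc_image: "finite (trunc n ` bounded_trees D)"
proof (induction n)
  case (Suc n)
  have "trunc (Suc n) ` bounded_trees D \<subseteq>
      Node ` {cs. set cs \<subseteq> trunc n ` bounded_trees D \<and> length cs \<le> D}"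
  proof
    fix s assume "s \<in> trunc (Suc n) ` bounded_trees D"
    then obtain t where t: "t \<in> bounded_trees D" "s = trunc (Suc n) t" by auto
    obtain cs where "t = Node cs" by (cases t)
    with t have "s = Node (map (trunc n) cs)"
      "map (trunc n) cs \<in> {cs. set cs \<subseteq> trunc n ` bounded_trees D \<and> length cs \<le> D}"
      by (auto simp: Node_in_bounded_trees_iff)
    then show "s \<in> Node ` {cs. set cs \<subseteq> trunc n ` bounded_trees D \<and> length cs \<le> D}"
      by (rule image_eqI)
  qed
  then show ?case
    by (rule finite_subset) (intro finite_imageI finite_lists_length_le Suc)
qed (rule finite_subset[of _ "{Node []}"], auto)

definition tree_profile :: "nat \<Rightarrow> plane_tree \<Rightarrow> nat list" where
  "tree_profile n t = map (\<lambda>i. level_size i t) [0..<Suc n]"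

lemma tree_profile_trunc: "n \<le> m \<Longrightarrow> tree_profile n (trunc m t) = tree_profile n t"
  by (simp add: tree_profile_def level_size_trunc del: upt_Suc)

lemma tree_profile_eq_iff:
  "tree_profile n t = map x [0..<Suc n] \<longleftrightarrow> (\<forall>i\<le>n. level_size i t = x i)"
  by (auto simp: tree_profile_def less_Suc_eq_le simp del: upt_Suc)

lemma tree_profile_Suc: "tree_profile (Suc n) t = tree_profile n t @ [level_size (Suc n) t]"
  by (simp add: tree_profile_def)

lemma last_tree_profile: "last (tree_profile n t) = level_size n t"
  by (simp add: tree_profile_def)

lemma hd_tree_profile: "hd (tree_profile n t) = 1"
  by (simp add: tree_profile_def upt_conv_Cons del: upt_Suc)

definition boltzmann_weight :: "(nat \<Rightarrow> real) \<Rightarrow> real \<Rightarrow> nat \<Rightarrow> real" where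
  "boltzmann_weight E \<beta> i = exp (- \<beta> * E i)"

section \<open>The constants and the Gibbs measures\<close>

locale limit_tree_law =
  fixes D :: nat and E :: "nat \<Rightarrow> real" and \<beta> :: real and P :: "plane_tree measure"
  assumes D2: "D \<ge> 2" and law: "is_limit_tree_law D E \<beta> P"
begin

abbreviation w :: "nat \<Rightarrow> real" where
  "w \<equiv> boltzmann_weight E \<beta>"

sublocale branching_weights D w
  by unfold_locales (use D2 in \<open>auto simp: boltzmann_weight_def\<close>)

lemma rho_eq: "rho D E \<beta> = r"
  by (simp add: rho_def r_def boltzmann_weight_def)

text \<open>With \<open>q i = w i * r ^ i / phi r\<close>, the free energy of \<open>p\<close> in
  the simplex is \<open>ln s\<close> plus the entropy of \<open>p\<close> relative to
  \<open>q\<close>. Hence it is minimal at \<open>q\<close>, with value \<open>ln s\<close>.\<close>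

lemma sigma_const_eq: "sigma_const D E \<beta> = s"
proof -
  have phi: "phi r > 0" using phi_pos r_pos by simp
  define q where "q i = w i * r ^ i / phi r" for i
  have q_pos: "q i > 0" for i using phi r_pos w[of i] by (simp add: q_def)
  have sum_q: "(\<Sum>i\<le>D. q i) = 1"
    using phi by (simp add: q_def phi_def flip: sum_divide_distrib)
  have mean_q: "(\<Sum>i\<le>D. real i * q i) = 1"
    using phi r_critical by (simp add: q_def mult.assoc flip: sum_divide_distrib)
  have ln_q: "ln (q i) = - \<beta> * E i + real i * ln r - ln (phi r)" for i
    using phi r_pos w[of i] by (simp add: q_def ln_div ln_mult ln_realpow) (simp add: boltzmann_weight_def)
  have key: "free_energy D E \<beta> p = ln s + (\<Sum>i\<le>D. p i * ln (p i)) - (\<Sum>i\<le>D. p i * ln (q i))"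
    if "(\<Sum>i\<le>D. p i) = 1" "(\<Sum>i\<le>D. real i * p i) = 1" for p
  proof -
    have "(\<Sum>i\<le>D. p i * ln (q i)) =
        - \<beta> * (\<Sum>i\<le>D. p i * E i) + (\<Sum>i\<le>D. real i * p i) * ln r - (\<Sum>i\<le>D. p i) * ln (phi r)"
      unfolding ln_q
      by (simp add: algebra_simps sum.distrib sum_subtractf sum_negf sum_distrib_left sum_distrib_right)
    then show ?thesis
      using that phi r_pos by (simp add: free_energy_def s_def ln_div)
  qed
  \<comment> \<open>Points of the simplex are extensional on \<open>{..D}\<close>, hence the
    restriction.\<close>
  let ?q = "restrict q {..D}"
  have q_le: "q i \<le> 1" if "i \<le> D" for i
    unfolding sum_q[symmetric] using that q_pos by (intro member_le_sum) (auto simp: less_imp_le)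
  have q_in: "?q \<in> branching_simplex D"
    using sum_q mean_q q_le q_pos by (auto simp: branching_simplex_def less_imp_le)
  have "free_energy D E \<beta> ?q = ln s"
    using key[of ?q] sum_q mean_q by simp
  moreover have "ln s \<le> free_energy D E \<beta> p" if "p \<in> branching_simplex D" for p
    using key[of p] gibbs_inequality[of "{..D}" p q] that sum_q q_pos
    by (auto simp: branching_simplex_def PiE_iff)
  ultimately have "free_energy D E \<beta> (optimal_branching D E \<beta>) = ln s"
    unfolding optimal_branching_def
    using arg_min_equality[of "\<lambda>p. p \<in> branching_simplex D" ?q "free_energy D E \<beta>"] q_in by simp
  then show ?thesis using s_pos by (simp add: sigma_const_def)
qed

lemma bij_betw_singleton: "bij_betw (\<lambda>t. [t]) (trees_of_size D N) (finite_forests D 1 N)"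
  by (rule bij_betw_byWitness[where f' = hd])
    (auto simp: trees_of_size_def finite_forests_def finite_trees_def length_Suc_conv)

lemma finite_trees_of_size: "finite (trees_of_size D N)"
  using bij_betw_finite[OF bij_betw_singleton] finite_finite_forests by blast

lemma exp_tree_energy:
  "t \<in> trees_of_size D N \<Longrightarrow> exp (- \<beta> * tree_energy E t) = tree_weight w t"
  by (simp add: tree_energy_def tree_weight_def boltzmann_weight_def trees_of_size_def
      sum_distrib_left exp_sum flip: sum_negf)

lemma partition_function_eq: "partition_function D E \<beta> N = Z 1 N"
proof -
  have "partition_function D E \<beta> N = (\<Sum>t\<in>trees_of_size D N. forest_weight w [t])"
    unfolding partition_function_def
    by (intro sum.cong refl) (simp only: exp_tree_energy, simp add: forest_weight_def)
  then show ?thesis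
    unfolding Z_def by (simp only: sum.reindex_bij_betw[OF bij_betw_singleton])
qed

text \<open>A tree is treated as a forest with a single tree, which makes the forest sums
  applicable. That the weights sum to 1 has to be checked before \<open>embed_pmf\<close> can be
  evaluated.\<close>

lemma prob_gibbs:
  assumes N: "N \<ge> 1"
  shows "measure_pmf.prob (gibbs_pmf D E \<beta> N) {t. Q [t]} =
    (\<Sum>ts | ts \<in> finite_forests D 1 N \<and> Q ts. forest_weight w ts) / Z 1 N"
proof -
  let ?f = "\<lambda>t. if t \<in> trees_of_size D N
     then exp (- \<beta> * tree_energy E t) / partition_function D E \<beta> N else 0"
  let ?T = "trees_of_size D N"
  have Zp: "partition_function D E \<beta> N > 0"
    unfolding partition_function_eq using N by (rule Z_1_pos)
  have "(\<integral>\<^sup>+ t. ennreal (?f t) \<partial>count_space UNIV) = (\<Sum>t\<in>?T. ennreal (?f t))"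
    by (rule nn_integral_count_space') (auto simp: finite_trees_of_size)
  also have "\<dots> = ennreal (\<Sum>t\<in>?T. ?f t)"
    using Zp by (intro sum_ennreal) auto
  also have "(\<Sum>t\<in>?T. ?f t) = 1"
    using Zp by (simp add: partition_function_def flip: sum_divide_distrib)
  finally have pmf: "pmf (gibbs_pmf D E \<beta> N) t = ?f t" for t
    unfolding gibbs_pmf_def using Zp by (intro pmf_embed_pmf) auto
  have "measure_pmf.prob (gibbs_pmf D E \<beta> N) {t. Q [t]} =
      measure_pmf.prob (gibbs_pmf D E \<beta> N) {t \<in> ?T. Q [t]}"
    by (rule measure_prob_cong_0) (auto simp: pmf)
  also have "\<dots> = (\<Sum>t | t \<in> ?T \<and> Q [t]. ?f t)"
    by (simp add: measure_measure_pmf_finite finite_trees_of_size pmf)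
  also have "\<dots> = (\<Sum>t | t \<in> ?T \<and> Q [t]. forest_weight w [t] / Z 1 N)"
    by (intro sum.cong refl) (auto simp: forest_weight_def partition_function_eq simp flip: exp_tree_energy)
  also have "\<dots> = (\<Sum>t | t \<in> ?T \<and> Q [t]. forest_weight w [t]) / Z 1 N"
    by (simp only: sum_divide_distrib)
  also have "bij_betw (\<lambda>t. [t]) {t \<in> ?T. Q [t]} {ts \<in> finite_forests D 1 N. Q ts}"
    using bij_betw_singleton[of N] by (auto simp: bij_betw_def inj_on_def)
  then have "(\<Sum>t | t \<in> ?T \<and> Q [t]. forest_weight w [t]) =
      (\<Sum>ts | ts \<in> finite_forests D 1 N \<and> Q ts. forest_weight w ts)"
    by (rule sum.reindex_bij_betw)
  finally show ?thesis .
qed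

lemma level_profile_singleton: "level_profile n [t] = tree_profile n t"
  by (simp add: level_profile_def tree_profile_def forest_level_def)

lemma prob_gibbs_tree_profile:
  assumes N: "N \<ge> 1"
  shows "measure_pmf.prob (gibbs_pmf D E \<beta> (N + sum_list (butlast (1 # ks))))
      {t. tree_profile (length ks) t = 1 # ks} =
    profile_weight (1 # ks) * (Z (last (1 # ks)) N / Z 1 (N + sum_list (butlast (1 # ks))))"
  using prob_gibbs[of "N + sum_list (butlast (1 # ks))" "\<lambda>ts. level_profile (length ks) ts = 1 # ks"] N
    sum_forests_level_profile[of 1 N ks]
  by (simp only: level_profile_singleton) simp

section \<open>Measurability and passage to the limit\<close>

lemma prob_space_P: "prob_space P" and sets_P: "sets P = sets (tree_space D)"
  using law by (auto simp: is_limit_tree_law_def)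

sublocale prob_space P by (rule prob_space_P)

lemma space_P: "space P = bounded_trees D"
  using sets_eq_imp_space_eq[OF sets_P] by (simp add: tree_space_def space_measure_of_conv)

lemma measurable_trunc: "trunc n \<in> P \<rightarrow>\<^sub>M count_space UNIV"
proof -
  have "trunc n \<in> P \<rightarrow>\<^sub>M count_space (trunc n ` bounded_trees D)"
    unfolding measurable_count_space_eq2[OF finite_trunc_image]
  proof safe
    fix t assume "t \<in> space P"
    then show "trunc n t \<in> trunc n ` bounded_trees D" by (auto simp: space_P)
  next
    fix t
    have "trunc n -` {trunc n t} \<inter> space P = {u \<in> bounded_trees D. trunc n u = trunc n t}"
      by (auto simp: space_P)
    then show "trunc n -` {trunc n t} \<inter> space P \<in> sets P"
      unfolding sets_P tree_space_def
      by (subst sets_measure_of) (auto intro!: sigma_sets.Basic)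
  qed
  then show ?thesis
    by (rule measurable_compose) simp
qed

lemma measurable_of_trunc:
  assumes "\<And>t. f (trunc n t) = f t"
  shows "f \<in> P \<rightarrow>\<^sub>M count_space UNIV"
proof -
  have "(\<lambda>t. f (trunc n t)) \<in> P \<rightarrow>\<^sub>M count_space UNIV"
    by (rule measurable_compose[OF measurable_trunc]) simp
  then show ?thesis by (simp add: assms)
qed

lemma measurable_level_size [measurable]: "level_size n \<in> P \<rightarrow>\<^sub>M count_space UNIV"
  by (rule measurable_of_trunc[of _ n]) (simp add: level_size_trunc)

lemma measurable_tree_profile [measurable]: "tree_profile n \<in> P \<rightarrow>\<^sub>M count_space UNIV"
  by (rule measurable_of_trunc[of _ n]) (simp add: tree_profile_trunc)

lemma prob_gibbs_tendsto:
  "(\<lambda>N. measure_pmf.prob (gibbs_pmf D E \<beta> N) {t. tree_profile n t = ks})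
    \<longlonglongrightarrow> \<P>(t in P. tree_profile n t = ks)"
proof -
  \<comment> \<open>The law prescribes truncations at positive heights only; \<open>Suc n\<close>
    also covers \<open>n = 0\<close> and preserves the profile up to \<open>n\<close>.\<close>
  let ?A = "{t. tree_profile n t = ks}" and ?f = "trunc (Suc n)"
  obtain p where p: "(\<lambda>N. tv_dist (map_pmf ?f (gibbs_pmf D E \<beta> N)) p) \<longlonglongrightarrow> 0"
    "distr P (count_space UNIV) ?f = measure_pmf p"
  proof -
    have "Suc n \<ge> 1" by simp
    then show ?thesis
      using law that unfolding is_limit_tree_law_def is_truncated_limit_law_def by blast
  qed
  have vimage: "?f -` ?A = ?A" by (simp add: vimage_def tree_profile_trunc del: trunc.simps)
  have "measure_pmf.prob p ?A = \<P>(t in P. tree_profile n t = ks)"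
    unfolding p(2)[symmetric]
    by (subst measure_distr[OF measurable_trunc], simp, simp only: vimage)
      (auto intro!: arg_cong[where f = "measure P"])
  moreover have "(\<lambda>N. measure_pmf.prob (map_pmf ?f (gibbs_pmf D E \<beta> N)) ?A - measure_pmf.prob p ?A) \<longlonglongrightarrow> 0"
    by (rule Lim_null_comparison[OF _ p(1)])
      (intro always_eventually allI, simp only: real_norm_def prob_diff_le_tv_dist)
  then have "(\<lambda>N. measure_pmf.prob (gibbs_pmf D E \<beta> N) ?A) \<longlonglongrightarrow> measure_pmf.prob p ?A"
    by (simp only: vimage measure_map_pmf LIM_zero_iff)
  ultimately show ?thesis by simp
qed

text \<open>Among trees of size \<open>N + 1\<close>, the root has a single child with Gibbs
  probability \<open>w 1 * Z 1 N / Z 1 (N + 1)\<close>. This converges because the limit law exists,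
  and \<open>Z_1_ratio_limit\<close> then forces the value.\<close>

lemma Z_1_ratio: "(\<lambda>N. Z 1 N / Z 1 (Suc N)) \<longlonglongrightarrow> s"
proof -
  define a where "a = \<P>(t in P. tree_profile 1 t = [1, 1]) / w 1"
  have pw: "profile_weight [1, 1] = w 1" using D by (simp add: W_nth)
  have "(\<lambda>N. measure_pmf.prob (gibbs_pmf D E \<beta> (N + 1)) {t. tree_profile 1 t = [1, 1]} / w 1) \<longlonglongrightarrow> a"
    unfolding a_def
    by (intro tendsto_divide tendsto_const LIMSEQ_ignore_initial_segment[OF prob_gibbs_tendsto])
      (use w[of 1] in simp)
  moreover have "\<forall>\<^sub>F N in sequentially.
      measure_pmf.prob (gibbs_pmf D E \<beta> (N + 1)) {t. tree_profile 1 t = [1, 1]} / w 1 = Z 1 N / Z 1 (Suc N)"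
    using eventually_ge_at_top[of 1]
  proof eventually_elim
    case (elim N)
    show ?case using prob_gibbs_tree_profile[OF elim, of "[1]"] pw w[of 1] by simp
  qed
  ultimately have "(\<lambda>N. Z 1 N / Z 1 (Suc N)) \<longlonglongrightarrow> a"
    by (rule Lim_transform_eventually)
  with Z_1_ratio_limit show ?thesis by blast
qed

text \<open>Both sides are limits of the same Gibbs probabilities, the right one by
  \<open>Z_ratio\<close>.\<close>

lemma prob_tree_profile:
  "\<P>(t in P. tree_profile (length ks) t = 1 # ks) =
    profile_weight (1 # ks) * (real (last (1 # ks)) * r ^ (last (1 # ks) - 1) * s ^ sum_list (butlast (1 # ks)))"
proof (rule LIMSEQ_unique)
  let ?M = "sum_list (butlast (1 # ks))"
  show "(\<lambda>N. measure_pmf.prob (gibbs_pmf D E \<beta> (N + ?M)) {t. tree_profile (length ks) t = 1 # ks})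
      \<longlonglongrightarrow> \<P>(t in P. tree_profile (length ks) t = 1 # ks)"
    by (rule LIMSEQ_ignore_initial_segment[OF prob_gibbs_tendsto])
  have "\<forall>\<^sub>F N in sequentially. profile_weight (1 # ks) * (Z (last (1 # ks)) N / Z 1 (N + ?M)) =
      measure_pmf.prob (gibbs_pmf D E \<beta> (N + ?M)) {t. tree_profile (length ks) t = 1 # ks}"
    using eventually_ge_at_top[of 1]
    by eventually_elim (simp only: prob_gibbs_tree_profile)
  then show "(\<lambda>N. measure_pmf.prob (gibbs_pmf D E \<beta> (N + ?M)) {t. tree_profile (length ks) t = 1 # ks})
      \<longlonglongrightarrow> profile_weight (1 # ks) * (real (last (1 # ks)) * r ^ (last (1 # ks) - 1) * s ^ ?M)"
    by (rule Lim_transform_eventually[rotated])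
      (intro tendsto_mult tendsto_const Z_ratio[OF Z_1_ratio])
qed

section \<open>Transition probabilities of the level sizes\<close>

text \<open>The Doob transform of the kernel \<open>s ^ k * (W ^ k) $ m\<close> by the function
  \<open>k * r ^ (k - 1)\<close>. For \<open>k = 0\<close> division by zero makes it 0.\<close>

definition transition :: "nat \<Rightarrow> nat \<Rightarrow> real" where
  "transition k m = real m * r ^ (m - 1) / (real k * r ^ (k - 1)) * s ^ k * (W ^ k) $ m"

text \<open>Appending \<open>m\<close> to a profile adds one coefficient of a power of
  \<open>W\<close>, adds \<open>last ks\<close> to the exponent of \<open>s\<close>, and replaces
  the boundary factor of \<open>last ks\<close> by that of \<open>m\<close>. All this depends on
  \<open>ks\<close> through its last entry only, which is the Markov property.\<close>

lemma prob_tree_profile_Suc: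
  "\<P>(t in P. tree_profile n t = ks \<and> level_size (Suc n) t = m) =
    \<P>(t in P. tree_profile n t = ks) * transition (last ks) m"
proof (cases "hd ks = 1 \<and> length ks = Suc n")
  case True
  then obtain js where ks: "ks = 1 # js" "length js = n" by (cases ks) auto
  have "\<P>(t in P. tree_profile n t = ks \<and> level_size (Suc n) t = m) =
      \<P>(t in P. tree_profile (length (js @ [m])) t = 1 # js @ [m])"
    using ks by (simp add: tree_profile_Suc flip: append_Cons)
  also have "\<dots> = profile_weight ((1 # js) @ [m]) * (real m * r ^ (m - 1) * s ^ sum_list (1 # js))"
    by (subst prob_tree_profile) (simp add: butlast_append)
  also have "\<dots> = profile_weight (1 # js) * (W ^ last (1 # js)) $ m * (real m * r ^ (m - 1) * s ^ sum_list (1 # js))"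
    by (subst profile_weight_snoc) auto
  also have "sum_list (1 # js) = sum_list (butlast (1 # js)) + last (1 # js)"
  proof -
    have "sum_list (1 # js) = sum_list (butlast (1 # js) @ [last (1 # js)])"
      by (subst append_butlast_last_id) auto
    then show ?thesis by (simp only: sum_list_append) simp
  qed
  also have "profile_weight (1 # js) * (W ^ last (1 # js)) $ m *
      (real m * r ^ (m - 1) * s ^ (sum_list (butlast (1 # js)) + last (1 # js))) =
      \<P>(t in P. tree_profile n t = ks) * transition (last ks) m"
  proof (cases "last (1 # js) = 0")
    \<comment> \<open>On the left, \<open>W ^ 0\<close> has no coefficient but the constant one, and
      there the factor \<open>m\<close> vanishes; on the right, the factor
      \<open>last (1 # js)\<close> vanishes.\<close>
    case True
    then show ?thesis
      unfolding ks(1) ks(2)[symmetric] prob_tree_profile by simp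
  next
    case False
    then show ?thesis
      unfolding ks(1) ks(2)[symmetric] prob_tree_profile transition_def
      using r_pos by (simp add: power_add del: last.simps butlast.simps sum_list.Cons)
  qed
  finally show ?thesis .
next
  case False
  have "tree_profile n t \<noteq> ks" for t
  proof
    assume "tree_profile n t = ks"
    moreover have "length (tree_profile n t) = Suc n" by (simp add: tree_profile_def)
    ultimately show False using hd_tree_profile[of n t] False by simp
  qed
  then show ?thesis by simp
qed

text \<open>Summation over the finitely many possible profiles that end in \<open>k\<close>; they
  share the factor \<open>transition k m\<close>.\<close>

lemma prob_level_size_Suc:
  "\<P>(t in P. level_size (Suc n) t = m \<and> level_size n t = k) =
    \<P>(t in P. level_size n t = k) * transition k m"
proof -
  define H where "H = {ks. set ks \<subseteq> {..D ^ n} \<and> length ks = Suc n}"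
  have fin: "finite H" unfolding H_def by (rule finite_lists_length_eq) simp
  have H: "tree_profile n t \<in> H" if "t \<in> space P" for t
  proof -
    have "level_size i t \<le> D ^ n" if "i \<le> n" for i
    proof (rule order_trans)
      show "level_size i t \<le> D ^ i" using \<open>t \<in> space P\<close> by (simp add: space_P level_size_le)
      show "D ^ i \<le> D ^ n" using that D by (intro power_increasing) auto
    qed
    then show ?thesis by (auto simp: H_def tree_profile_def)
  qed
  let ?H = "{ks \<in> H. last ks = k}"
  \<comment> \<open>Used with \<open>R\<close> fixing the size of the next level and with
    \<open>R\<close> true.\<close>
  have split: "\<P>(t in P. level_size n t = k \<and> R t) = (\<Sum>ks\<in>?H. \<P>(t in P. tree_profile n t = ks \<and> R t))"
    if [measurable]: "Measurable.pred P R" for R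
  proof -
    have "{t \<in> space P. level_size n t = k \<and> R t} = (\<Union>ks\<in>?H. {t \<in> space P. tree_profile n t = ks \<and> R t})"
      using H by (auto simp: last_tree_profile)
    moreover have "{t \<in> space P. tree_profile n t = ks \<and> R t} \<in> sets P" for ks
      by measurable
    ultimately show ?thesis
      using fin by (simp only:) (rule finite_measure_finite_Union, auto simp: disjoint_family_on_def)
  qed
  have "\<P>(t in P. level_size n t = k \<and> level_size (Suc n) t = m) =
      (\<Sum>ks\<in>?H. \<P>(t in P. tree_profile n t = ks \<and> level_size (Suc n) t = m))"
    by (rule split) measurable
  also have "\<dots> = (\<Sum>ks\<in>?H. \<P>(t in P. tree_profile n t = ks \<and> True) * transition k m)"
    by (intro sum.cong refl) (simp add: prob_tree_profile_Suc)
  also have "\<dots> = \<P>(t in P. level_size n t = k \<and> True) * transition k m"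
    by (subst split) (auto simp: sum_distrib_right)
  finally show ?thesis by (simp add: conj_commute)
qed

lemma cond_prob_level_size:
  assumes "\<P>(t in P. level_size n t = k) > 0"
  shows "\<P>(t in P. level_size (Suc n) t = m \<bar> level_size n t = k) = transition k m"
  using assms by (simp add: cond_prob_def prob_level_size_Suc)

lemma is_markov_level_size: "is_markov P level_size"
  unfolding is_markov_def
proof (intro conjI allI impI)
  fix n y and x :: "nat \<Rightarrow> nat"
  assume pos: "\<P>(t in P. \<forall>i\<le>n. level_size i t = x i) > 0"
  let ?ks = "map x [0..<Suc n]"
  have "\<P>(t in P. \<forall>i\<le>n. level_size i t = x i) \<le> \<P>(t in P. level_size n t = x n)"
    by (rule finite_measure_mono) auto
  then have "\<P>(t in P. level_size n t = x n) > 0"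
    using pos by simp
  then have "\<P>(t in P. level_size (Suc n) t = y \<bar> level_size n t = x n) = transition (x n) y"
    by (rule cond_prob_level_size)
  moreover have "\<P>(t in P. level_size (Suc n) t = y \<bar> \<forall>i\<le>n. level_size i t = x i) = transition (x n) y"
  proof -
    have "last ?ks = x n" by simp
    then show ?thesis
      using pos prob_tree_profile_Suc[of n ?ks y]
      by (simp add: cond_prob_def tree_profile_eq_iff conj_commute del: upt_Suc)
  qed
  ultimately show "\<P>(t in P. level_size (Suc n) t = y \<bar> \<forall>i\<le>n. level_size i t = x i) =
      \<P>(t in P. level_size (Suc n) t = y \<bar> level_size n t = x n)"
    by simp
qed measurable

lemma transition_eq:
  assumes "k \<ge> 1" "m \<ge> 1"
  shows "transition k m = real m / real k * r powi (int m - int k) * s ^ k *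
    (\<Sum>is | length is = k \<and> set is \<subseteq> {..D} \<and> sum_list is = m. exp (- \<beta> * (\<Sum>i\<leftarrow>is. E i)))"
proof -
  have "(\<Prod>i\<leftarrow>is. w i) = exp (- \<beta> * (\<Sum>i\<leftarrow>is. E i))" for "is"
    by (induction "is") (simp_all add: boltzmann_weight_def algebra_simps flip: exp_add)
  then have "(W ^ k) $ m =
      (\<Sum>is | length is = k \<and> set is \<subseteq> {..D} \<and> sum_list is = m. exp (- \<beta> * (\<Sum>i\<leftarrow>is. E i)))"
    by (simp add: W_power_nth_words words_def)
  moreover have "r ^ (m - 1) / r ^ (k - 1) = r powi (int m - int k)"
  proof -
    \<comment> \<open>As \<open>k\<close> and \<open>m\<close> are positive, \<open>m - 1\<close>
      and \<open>k - 1\<close> are not truncated and have the same difference.\<close>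
    have "r powi (int m - int k) = r powi (int (m - 1) - int (k - 1))"
      using assms by (simp add: of_nat_diff)
    also have "\<dots> = r ^ (m - 1) / r ^ (k - 1)"
      using r_pos by (subst power_int_diff) auto
    finally show ?thesis by simp
  qed
  ultimately show ?thesis
    unfolding transition_def by (simp flip: times_divide_times_eq)
qed

end

theorem theorem8:
  fixes D :: nat and E :: "nat \<Rightarrow> real" and \<beta> :: real and P :: "plane_tree measure"
  assumes "D \<ge> 2" and "is_limit_tree_law D E \<beta> P"
  shows "is_markov P level_size \<and>
    (\<forall>n k k'. k \<ge> 1 \<longrightarrow> k' \<ge> 1 \<longrightarrow> \<P>(t in P. level_size n t = k) > 0 \<longrightarrow>
      \<P>(t in P. level_size (Suc n) t = k' \<bar> level_size n t = k) =
        real k' / real k * rho D E \<beta> powi (int k' - int k) * sigma_const D E \<beta> ^ k *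
        (\<Sum>is \<in> {is. length is = k \<and> set is \<subseteq> {..D} \<and> sum_list is = k'}.
           exp (- \<beta> * (\<Sum>i\<leftarrow>is. E i))))"
proof -
  interpret limit_tree_law D E \<beta> P
    by unfold_locales (use assms in auto)
  show ?thesis
    by (auto simp: is_markov_level_size cond_prob_level_size transition_eq rho_eq sigma_const_eq)
qed

end
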